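(* Let $g:\mathbb{R}^m\to(-\infty,+\infty]$ and $h:\mathbb{R}^n\to(-\infty,+\infty]$ be closed and proper convex functions and let $\mathbf{A}\in\mathbb{R}^{m\times n}$. Consider the minimax problem $$(\hat{\mathbf{z}},\hat{\mathbf{x}})\in\arg\min_{\mathbf{z}}\max_{\mathbf{x}}\ \Omega(\mathbf{z},\mathbf{x}),\qquad \Omega(\mathbf{z},\mathbf{x})=\langle-\mathbf{A}'\mathbf{z},\mathbf{x}\rangle+g^*(\mathbf{z})-h(\mathbf{x}).$$ Suppose it has a saddle-point $(\hat{\mathbf{z}},\hat{\mathbf{x}})$, where $\hat{\mathbf{z}}$ and $\hat{\mathbf{x}}$ are the solutions of the primal problem $\min_{\mathbf{z}}\{h^*(-\mathbf{A}'\mathbf{z})+g^*(\mathbf{z})\}$ and the dual problem $\max_{\mathbf{x}}\{-g(\mathbf{A}\mathbf{x})-h(\mathbf{x})\}$ of the minimax problem, respectively. Let $\rho>0$, let $L>\|\mathbf{A}\|_2^2$ and $t=1/L$, and let $\{\varepsilon_k\}_{k=0}^\infty$ denote a non-negative sequence such that $$\sum_{k=0}^\infty\sqrt{\varepsilon_k}<\infty.$$ Then the sequence of updates $\{(-\rho\mathbf{d}^{(k)},\mathbf{x}^{(k)})\}_{k=0}^\infty$ generated by the inexact linearized augmented Lagrangian method with errors $\varepsilon_k$ (defined in the context) is a bounded sequence that converges to $(\hat{\mathbf{z}},\hat{\mathbf{x}})$, and the primal-dual gap of $(\mathbf{z}_k,\mathbf{x}_k)$ has the following bound: $$\Omega(\mathbf{z}_k,\hat{\mathbf{x}})-\Omega(\hat{\mathbf{z}},\mathbf{x}_k)\le\frac{\big(C+2A_k+\sqrt{B_k}\big)^2}{k},$$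 where $\mathbf{z}_k=\frac1k\sum_{j=1}^k(-\rho\mathbf{d}^{(j)})$, $\mathbf{x}_k=\frac1k\sum_{j=1}^k\mathbf{x}^{(j)}$, $$C=\frac{\|\mathbf{x}^{(0)}-\hat{\mathbf{x}}\|_2}{\sqrt{2\rho^{-1}t}}+\frac{\|(-\rho\mathbf{d}^{(0)})-\hat{\mathbf{z}}\|_2}{\sqrt{2\rho}},\qquad A_k=\sum_{j=1}^k\sqrt{\frac{\varepsilon_{j-1}}{(1-t\|\mathbf{A}\|_2^2)\,\rho^{-1}t}},\qquad B_k=\sum_{j=1}^k\varepsilon_{j-1}.$$
   Context: $\mathbf{A}'$ is the transpose of $\mathbf{A}$, $\|\mathbf{A}\|_2$ is the spectral norm, so $\|\mathbf{A}\|_2^2=\lambda_{\max}(\mathbf{A}'\mathbf{A})$, and $f^*$ denotes the convex conjugate of a function $f$. A saddle-point $(\hat{\mathbf{z}},\hat{\mathbf{x}})$ of the minimax problem satisfies $\Omega(\hat{\mathbf{z}},\mathbf{x})\le\Omega(\hat{\mathbf{z}},\hat{\mathbf{x}})\le\Omega(\mathbf{z},\hat{\mathbf{x}})$ for all $\mathbf{z},\mathbf{x}$. For given $(\mathbf{x}^{(k)},\mathbf{u}^{(k)},\mathbf{d}^{(k)})\in\mathbb{R}^n\times\mathbb{R}^m\times\mathbb{R}^m$ define $$\theta_k(\mathbf{x})=\tfrac{\rho}{2}\|\mathbf{A}\mathbf{x}-\mathbf{u}^{(k)}-\mathbf{d}^{(k)}\|_2^2,$$ $$\breve{\theta}_k(\mathbf{x};\mathbf{x}^{(k)})=\theta_k(\mathbf{x}^{(k)})+\langle\nabla\theta_k(\mathbf{x}^{(k)}),\mathbf{x}-\mathbf{x}^{(k)}\rangle+\tfrac{\rho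 L}{2}\|\mathbf{x}-\mathbf{x}^{(k)}\|_2^2,$$ $$\phi_k(\mathbf{x})=h(\mathbf{x})+\breve{\theta}_k(\mathbf{x};\mathbf{x}^{(k)}).$$ Inexact linearized augmented Lagrangian method with errors $\varepsilon_k$: starting from an initial $(\mathbf{x}^{(0)},\mathbf{u}^{(0)},\mathbf{d}^{(0)})$, for $k=0,1,2,\dots$ the iterates satisfy $$\Big|\phi_k(\mathbf{x}^{(k+1)})-\min_{\mathbf{x}}\phi_k(\mathbf{x})\Big|\le\varepsilon_k,$$ $$\mathbf{u}^{(k+1)}\in\arg\min_{\mathbf{u}}\Big\{g(\mathbf{u})+\tfrac{\rho}{2}\|\mathbf{A}\mathbf{x}^{(k+1)}-\mathbf{u}-\mathbf{d}^{(k)}\|_2^2\Big\},$$ $$\mathbf{d}^{(k+1)}=\mathbf{d}^{(k)}-\mathbf{A}\mathbf{x}^{(k+1)}+\mathbf{u}^{(k+1)}.$$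
   Formalization: As printed the claim is false. Proved: convergence to some saddle-point (not a prescribed one); the gap bound assumes u^(0)=Ax^(0), with the printed A_k if t/ρ ≤ 1, and in general with A_k lacking the factor ρ^{-1}t in its denominator. *)

theory Defs
  imports "HOL-Analysis.Analysis"
begin

(* Closed proper convex functions in the sense of convex analysis: closedness (lower
   semicontinuity) and convexity are those of the epigraph.  The library's convex_on and
   epigraph only cover real-valued functions. *)

definition epigraph_ereal :: "('a \<Rightarrow> ereal) \<Rightarrow> ('a \<times> real) set" where
  "epigraph_ereal f = {(x, r). f x \<le> ereal r}"

definition closed_proper_convex :: "('a::euclidean_space \<Rightarrow> ereal) \<Rightarrow> bool" where
  "closed_proper_convex f \<longleftrightarrow>
     closed (epigraph_ereal f) \<and> convex (epigraph_ereal f) \<and>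
     (\<forall>x. f x \<noteq> -\<infinity>) \<and> (\<exists>x. f x \<noteq> \<infinity>)"

definition convex_conjugate :: "('a::real_inner \<Rightarrow> ereal) \<Rightarrow> 'a \<Rightarrow> ereal" where
  "convex_conjugate f y = (SUP x. ereal (inner y x) - f x)"

definition saddle_point :: "('a \<Rightarrow> 'b \<Rightarrow> ereal) \<Rightarrow> 'a \<Rightarrow> 'b \<Rightarrow> bool" where
  "saddle_point \<Omega> z x \<longleftrightarrow>
     (\<forall>x'. \<Omega> z x' \<le> \<Omega> z x) \<and> (\<forall>z'. \<Omega> z x \<le> \<Omega> z' x)"

(* The gradient of a real-valued function; only meaningful where f is differentiable. *)
definition gradient :: "('a::real_inner \<Rightarrow> real) \<Rightarrow> 'a \<Rightarrow> 'a" where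
  "gradient f x = (THE D. GDERIV f x :> D)"

(* In ereal, \<infinity> - \<infinity> = \<infinity>, so the value is \<infinity> whenever g^*(z) = \<infinity>.  For proper g, h this choice
   does not matter for saddle points: they always satisfy g^*(z) < \<infinity> and h(x) < \<infinity>. *)
definition Omega ::
  "real^'n^'m \<Rightarrow> (real^'m \<Rightarrow> ereal) \<Rightarrow> (real^'n \<Rightarrow> ereal) \<Rightarrow> real^'m \<Rightarrow> real^'n \<Rightarrow> ereal" where
  "Omega A g h z x = ereal (inner (- (transpose A *v z)) x) + convex_conjugate g z - h x"

definition primal_objective ::
  "real^'n^'m \<Rightarrow> (real^'m \<Rightarrow> ereal) \<Rightarrow> (real^'n \<Rightarrow> ereal) \<Rightarrow> real^'m \<Rightarrow> ereal" where
  "primal_objective A g h z = convex_conjugate h (- (transpose A *v z)) + convex_conjugate g z"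

definition dual_objective ::
  "real^'n^'m \<Rightarrow> (real^'m \<Rightarrow> ereal) \<Rightarrow> (real^'n \<Rightarrow> ereal) \<Rightarrow> real^'n \<Rightarrow> ereal" where
  "dual_objective A g h x = - g (A *v x) - h x"

definition saddle_point_solution ::
  "real^'n^'m \<Rightarrow> (real^'m \<Rightarrow> ereal) \<Rightarrow> (real^'n \<Rightarrow> ereal) \<Rightarrow> real^'m \<Rightarrow> real^'n \<Rightarrow> bool" where
  "saddle_point_solution A g h z x \<longleftrightarrow>
     saddle_point (Omega A g h) z x \<and>
     is_arg_min (primal_objective A g h) (\<lambda>_. True) z \<and>
     is_arg_max (dual_objective A g h) (\<lambda>_. True) x"

(* The spectral norm is the operator norm for the Euclidean norms. *)
definition spectral_norm :: "real^'n^'m \<Rightarrow> real" where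
  "spectral_norm A = onorm ((*v) A)"

definition theta :: "real^'n^'m \<Rightarrow> real \<Rightarrow> real^'m \<Rightarrow> real^'m \<Rightarrow> real^'n \<Rightarrow> real" where
  "theta A \<rho> u d x = \<rho> / 2 * (norm (A *v x - u - d))\<^sup>2"

definition theta_breve ::
  "real^'n^'m \<Rightarrow> real \<Rightarrow> real \<Rightarrow> real^'m \<Rightarrow> real^'m \<Rightarrow> real^'n \<Rightarrow> real^'n \<Rightarrow> real" where
  "theta_breve A \<rho> L u d xk x =
     theta A \<rho> u d xk + inner (gradient (theta A \<rho> u d) xk) (x - xk)
     + \<rho> * L / 2 * (norm (x - xk))\<^sup>2"

definition phi ::
  "real^'n^'m \<Rightarrow> (real^'n \<Rightarrow> ereal) \<Rightarrow> real \<Rightarrow> real \<Rightarrow> real^'n \<Rightarrow> real^'m \<Rightarrow> real^'m \<Rightarrow> real^'n \<Rightarrow> ereal"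
  where
  "phi A h \<rho> L xk u d x = h x + ereal (theta_breve A \<rho> L u d xk x)"

(* For closed proper convex h and \<rho>, L > 0 the function phi is strongly convex, so the
   infimum below is a finite, attained minimum. *)
definition inexact_LALM ::
  "real^'n^'m \<Rightarrow> (real^'m \<Rightarrow> ereal) \<Rightarrow> (real^'n \<Rightarrow> ereal) \<Rightarrow> real \<Rightarrow> real \<Rightarrow> (nat \<Rightarrow> real) \<Rightarrow>
   (nat \<Rightarrow> real^'n) \<Rightarrow> (nat \<Rightarrow> real^'m) \<Rightarrow> (nat \<Rightarrow> real^'m) \<Rightarrow> bool" where
  "inexact_LALM A g h \<rho> L \<epsilon> x u d \<longleftrightarrow>
     (\<forall>k.
       \<bar>phi A h \<rho> L (x k) (u k) (d k) (x (Suc k)) - (INF y. phi A h \<rho> L (x k) (u k) (d k) y)\<bar>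
         \<le> ereal (\<epsilon> k) \<and>
       is_arg_min (\<lambda>v. g v + ereal (\<rho> / 2 * (norm (A *v x (Suc k) - v - d k))\<^sup>2)) (\<lambda>_. True)
         (u (Suc k)) \<and>
       d (Suc k) = d k - A *v x (Suc k) + u (Suc k))"

end

theory Submission
  imports Defs
begin

text \<open>
  With \<open>z k = - \<rho> *\<^sub>R d k\<close> and \<open>r k = \<rho> *\<^sub>R (A *v x k - u k)\<close> the method is the
  primal-dual iteration of Chambolle and Pock in disguise.  The dual update gives
  \<open>z (Suc k) = z k + r (Suc k)\<close> with \<open>z (Suc k)\<close> a subgradient of \<open>g\<close> at
  \<open>u (Suc k)\<close>, that is, an exact proximal step for the conjugate of \<open>g\<close>.  The linearized
  update of \<open>x\<close> is a proximal step for \<open>h\<close> of size \<open>\<tau> = t / \<rho>\<close>, driven by the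
  extrapolated point \<open>z k + r k\<close> and exact up to \<open>\<epsilon> k\<close> in the objective.  The condition
  on \<open>L\<close> is the step size condition \<open>\<tau> * \<rho> * (spectral_norm A)\<^sup>2 < 1\<close>.

  An error \<open>\<epsilon>\<close> in the objective of a proximal step costs
  \<open>\<epsilon> + sqrt (2 * \<epsilon> / \<tau>) * norm (p - x (Suc k))\<close> in its three-point inequality at \<open>p\<close>
  (\<open>approximate_prox_inequality\<close>).  Adding the inequalities of both steps shows that an energy,
  which bounds the squared distance from a saddle point, decreases by the primal-dual gap and by the
  squared increments, up to these errors (\<open>energy_descent\<close>).  The distance also occurs in the
  error terms; a discrete quadratic Gronwall argument (\<open>quadratic_recursion_bound\<close>) removes it and
  yields both boundedness and the bound on the sum of the gaps (\<open>gap_sum_le\<close>).  Convexity passes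
  from the sum to the gap at the averaged iterates.

  For convergence, a slightly different weight in the energy makes the increments square summable.  A
  limit point of the iterates then satisfies the optimality conditions, hence is a saddle point, and the
  energy relative to it converges with a subsequence tending to 0 (\<open>convergence\<close>).  The limit also
  solves the primal and the dual problem (\<open>saddle_point_solution_if_subgradients\<close>).

  The error sum obtained in this way has the denominator \<open>1 - t * (spectral_norm A)\<^sup>2\<close>; the
  variant with the additional factor \<open>inverse \<rho> * t\<close> is no smaller when this factor is at most 1.
\<close>

section \<open>Extended-valued convex functions\<close>

lemma epigraph_convexD:
  assumes "convex (epigraph_ereal f)" "f p \<le> ereal a" "f q \<le> ereal b" "0 \<le> l" "l \<le> 1"
  shows "f ((1 - l) *\<^sub>R p + l *\<^sub>R q) \<le> ereal ((1 - l) * a + l * b)"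
proof -
  have "(p, a) \<in> epigraph_ereal f" "(q, b) \<in> epigraph_ereal f"
    using assms by (auto simp: epigraph_ereal_def)
  then have "(1 - l) *\<^sub>R (p, a) + l *\<^sub>R (q, b) \<in> epigraph_ereal f"
    using assms by (intro convexD) auto
  then show ?thesis by (simp add: epigraph_ereal_def)
qed

lemma epigraph_convex_mean:
  fixes p :: "nat \<Rightarrow> 'a::real_vector"
  assumes "convex (epigraph_ereal f)" "\<And>j. j \<in> {1..k} \<Longrightarrow> f (p j) \<le> ereal (b j)" "k \<ge> 1"
  shows "f ((1 / real k) *\<^sub>R (\<Sum>j=1..k. p j)) \<le> ereal ((\<Sum>j=1..k. b j) / real k)"
proof -
  have "(\<Sum>j=1..k. (1 / real k) *\<^sub>R (p j, b j)) \<in> epigraph_ereal f"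
    using assms by (intro convex_sum) (auto simp: epigraph_ereal_def)
  also have "(\<Sum>j=1..k. (1 / real k) *\<^sub>R (p j, b j))
      = ((1 / real k) *\<^sub>R (\<Sum>j=1..k. p j), (\<Sum>j=1..k. b j) / real k)"
    by (simp add: prod_eq_iff fst_sum snd_sum scaleR_sum_right sum_divide_distrib)
  finally show ?thesis by (simp add: epigraph_ereal_def)
qed

lemma epigraph_closedD:
  fixes f :: "'a::euclidean_space \<Rightarrow> ereal"
  assumes "closed (epigraph_ereal f)" "p \<longlonglongrightarrow> q" "a \<longlonglongrightarrow> b" "\<And>k. f (p k) \<le> ereal (a k)"
  shows "f q \<le> ereal b"
proof -
  have "(q, b) \<in> epigraph_ereal f"
    using assms(4) by (intro closed_sequentially[OF assms(1) _ tendsto_Pair[OF assms(2,3)]])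
      (auto simp: epigraph_ereal_def)
  then show ?thesis by (simp add: epigraph_ereal_def)
qed

text \<open>Finiteness of the value at \<open>p\<close> is built in: where \<open>f\<close> is infinite the
  inequality alone would be satisfied by every vector or by none.\<close>

definition subgradient :: "('a::real_inner \<Rightarrow> ereal) \<Rightarrow> 'a \<Rightarrow> 'a \<Rightarrow> bool" where
  "subgradient f p v \<longleftrightarrow> \<bar>f p\<bar> \<noteq> \<infinity> \<and> (\<forall>q. f p + ereal (inner v (q - p)) \<le> f q)"

lemma subgradientD:
  assumes "subgradient f p v"
  shows "f p = ereal (real_of_ereal (f p))"
    and "f q \<noteq> \<infinity> \<Longrightarrow> real_of_ereal (f p) + inner v (q - p) \<le> real_of_ereal (f q)"
proof -
  obtain a where a: "f p = ereal a"
    using assms by (cases "f p") (auto simp: subgradient_def)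
  then show "f p = ereal (real_of_ereal (f p))" by simp
  have le: "ereal (a + inner v (q - p)) \<le> f q"
    using assms a by (auto simp: subgradient_def)
  show "f q \<noteq> \<infinity> \<Longrightarrow> real_of_ereal (f p) + inner v (q - p) \<le> real_of_ereal (f q)"
    using le a by (cases "f q") auto
qed

lemma closed_proper_convex_finite:
  "closed_proper_convex f \<Longrightarrow> f p \<noteq> \<infinity> \<Longrightarrow> f p = ereal (real_of_ereal (f p))"
  by (cases "f p") (auto simp: closed_proper_convex_def)

lemma closed_proper_convex_domain:
  assumes "closed_proper_convex f"
  obtains p where "f p \<noteq> \<infinity>"
  using assms by (auto simp: closed_proper_convex_def)

text \<open>Subgradients survive limits even when each of them holds only up to an error that vanishes
  along the sequence; this is where lower semicontinuity is used.\<close>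

lemma subgradient_limit:
  fixes f :: "'a::euclidean_space \<Rightarrow> ereal"
  assumes f: "closed_proper_convex f" and p: "p \<longlonglongrightarrow> p'"
    and bound: "\<And>q k. f q \<noteq> \<infinity> \<Longrightarrow> f (p k) \<le> ereal (a q k)"
    and lim: "\<And>q. f q \<noteq> \<infinity> \<Longrightarrow> (\<lambda>k. a q k) \<longlonglongrightarrow> real_of_ereal (f q) - inner v (q - p')"
  shows "subgradient f p' v"
proof -
  have le: "f p' \<le> ereal (real_of_ereal (f q) - inner v (q - p'))" if "f q \<noteq> \<infinity>" for q
    using f by (intro epigraph_closedD[OF _ p lim[OF that] bound[OF that]])
      (auto simp: closed_proper_convex_def)
  obtain q where "f q \<noteq> \<infinity>" using f by (rule closed_proper_convex_domain)
  from le[OF this] have fin: "f p' \<noteq> \<infinity>" by auto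
  obtain b where b: "f p' = ereal b" using closed_proper_convex_finite[OF f fin] by metis
  have "f p' + ereal (inner v (q - p')) \<le> f q" for q
  proof (cases "f q = \<infinity>")
    case False
    then obtain c where "f q = ereal c" using closed_proper_convex_finite[OF f] by metis
    then show ?thesis using le[OF False] b by simp
  qed simp
  then show ?thesis using b by (simp add: subgradient_def)
qed

lemma fenchel_young:
  "f p = ereal a \<Longrightarrow> ereal (inner v p - a) \<le> convex_conjugate f v"
  unfolding convex_conjugate_def by (rule SUP_upper2[of p]) auto

text \<open>A subgradient turns the Fenchel--Young inequality into an equality.  This gives the value of the
  conjugate at the dual iterates and at their limit, so that the biconjugate never enters.\<close>

lemma conjugate_at_subgradient:
  assumes "subgradient f p v"
  shows "convex_conjugate f v = ereal (inner v p - real_of_ereal (f p))"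
proof (rule antisym)
  obtain a where a: "f p = ereal a" using subgradientD(1)[OF assms] by metis
  show "ereal (inner v p - real_of_ereal (f p)) \<le> convex_conjugate f v"
    using fenchel_young[of f p a v] a by simp
  show "convex_conjugate f v \<le> ereal (inner v p - real_of_ereal (f p))"
    unfolding convex_conjugate_def
  proof (rule SUP_least)
    fix q
    have "ereal (a + inner v (q - p)) \<le> f q"
      using assms a by (auto simp: subgradient_def)
    then show "ereal (inner v q) - f q \<le> ereal (inner v p - real_of_ereal (f p))"
      using a by (cases "f q") (auto simp: inner_diff_right)
  qed
qed

lemma conjugate_not_MInf:
  assumes "closed_proper_convex f"
  shows "convex_conjugate f v \<noteq> -\<infinity>"
proof -
  obtain p where "f p \<noteq> \<infinity>" using assms by (rule closed_proper_convex_domain)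
  then obtain a where "f p = ereal a" using closed_proper_convex_finite[OF assms] by metis
  from fenchel_young[where f=f, OF this, of v] show ?thesis by auto
qed

text \<open>The epigraph is an intersection of one set for each point \<open>p\<close>: a half-space if \<open>f p\<close> is
  finite, and otherwise empty or the whole space.\<close>

lemma convex_epigraph_conjugate: "convex (epigraph_ereal (convex_conjugate f))"
proof -
  have "epigraph_ereal (convex_conjugate f)
      = (\<Inter>p. {(v, a). ereal (inner v p) - f p \<le> ereal a})"
    by (auto simp: epigraph_ereal_def convex_conjugate_def SUP_le_iff)
  moreover have "convex {(v, a). ereal (inner v p) - f p \<le> ereal a}" for p
  proof (cases "f p")
    case (real b)
    have "{(v, a). ereal (inner v p) - f p \<le> ereal a} = {w. inner (p, -1) w \<le> b}"
      using real by (auto simp: inner_commute)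
    then show ?thesis by (simp add: convex_halfspace_le)
  qed auto
  ultimately show ?thesis by (auto intro: convex_INT)
qed

text \<open>Comparing the approximate minimiser \<open>p\<close> with the point at fraction \<open>l\<close> of the segment from
  \<open>p\<close> to \<open>q\<close>, and using strong convexity there, bounds the loss in the three-point inequality by
  \<open>e / l + l * c / 2 * (norm (q - p))\<^sup>2\<close>.  The best fraction is
  \<open>l = sqrt (2 * e / c) / norm (q - p)\<close>; when this exceeds 1, the endpoint \<open>q\<close> itself
  is good enough.  No exact minimiser is involved.\<close>

lemma approximate_prox_inequality:
  fixes f :: "'a::real_inner \<Rightarrow> ereal" and s w :: 'a and c :: real
  defines "\<Phi> \<equiv> \<lambda>b v. b + inner s v + c / 2 * (norm (v - w))\<^sup>2"
  assumes conv: "convex (epigraph_ereal f)" and c: "c > 0" and e: "e \<ge> 0"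
    and fp: "f p = ereal a" and fq: "f q = ereal b"
    and min: "\<And>v b. f v \<le> ereal b \<Longrightarrow> \<Phi> a p \<le> \<Phi> b v + e"
  shows "\<Phi> a p + c / 2 * (norm (q - p))\<^sup>2 \<le> \<Phi> b q + e + sqrt (2 * c * e) * norm (q - p)"
proof -
  define D where "D = norm (q - p)"
  have seg: "\<Phi> a p - \<Phi> b q + (1 - l) * (c / 2 * D\<^sup>2) \<le> e / l" if l: "0 < l" "l \<le> 1" for l
  proof -
    let ?v = "(1 - l) *\<^sub>R p + l *\<^sub>R q"
    have "f ?v \<le> ereal ((1 - l) * a + l * b)"
      using l fp fq by (intro epigraph_convexD[OF conv]) auto
    from min[OF this] have 1: "\<Phi> a p \<le> \<Phi> ((1 - l) * a + l * b) ?v + e" .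
    have "(norm (?v - w))\<^sup>2 = (1 - l) * (norm (p - w))\<^sup>2 + l * (norm (q - w))\<^sup>2 - l * (1 - l) * D\<^sup>2"
      unfolding D_def power2_norm_eq_inner
      by (simp add: inner_diff_left inner_diff_right inner_add_left inner_add_right
          inner_commute algebra_simps)
    moreover have "inner s ?v = (1 - l) * inner s p + l * inner s q"
      by (simp add: inner_add_right)
    ultimately have convex: "\<Phi> ((1 - l) * a + l * b) ?v
        = (1 - l) * \<Phi> a p + l * \<Phi> b q - c / 2 * (l * (1 - l) * D\<^sup>2)"
      unfolding \<Phi>_def by (simp only:) (simp add: field_simps)
    have "l * (\<Phi> a p - \<Phi> b q + (1 - l) * (c / 2 * D\<^sup>2)) \<le> e"
      using 1[unfolded convex] by (simp add: field_simps)
    then show ?thesis using l by (simp add: field_simps)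
  qed
  have "\<Phi> a p - \<Phi> b q + c / 2 * D\<^sup>2 \<le> e + sqrt (2 * c * e) * D"
  proof (cases "c * D \<le> sqrt (2 * c * e)")
    case True
    have D: "D \<ge> 0" by (simp add: D_def)
    have "c * D * D \<le> sqrt (2 * c * e) * D" using True D by (rule mult_right_mono)
    moreover have "0 \<le> sqrt (2 * c * e) * D" using c e D by simp
    ultimately show ?thesis using seg[of 1] by (simp add: power2_eq_square)
  next
    case False
    have D: "D > 0"
    proof (rule ccontr)
      assume "\<not> D > 0"
      then have "D = 0" by (simp add: D_def)
      then show False using False c e by simp
    qed
    show ?thesis
    proof (cases "e = 0")
      case True
      \<comment> \<open>For exact minimisers the optimal fraction degenerates to 0: let it tend there.\<close>
      have "((\<lambda>l. \<Phi> a p - \<Phi> b q + (1 - l) * (c / 2 * D\<^sup>2))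
          \<longlongrightarrow> \<Phi> a p - \<Phi> b q + (1 - 0) * (c / 2 * D\<^sup>2)) (at_right 0)"
        by (intro tendsto_intros)
      moreover have "\<forall>\<^sub>F l in at_right 0. \<Phi> a p - \<Phi> b q + (1 - l) * (c / 2 * D\<^sup>2) \<le> 0"
        by (rule eventually_mono[OF eventually_at_right_real[of 0 "1::real"]])
          (use seg True in auto)
      ultimately have "\<Phi> a p - \<Phi> b q + (1 - 0) * (c / 2 * D\<^sup>2) \<le> 0"
        by (rule tendsto_upperbound) simp
      then show ?thesis using True by simp
    next
      case False
      define S where "S = sqrt (2 * c * e)"
      have S: "S > 0" "S * S = 2 * c * e" using False e c by (auto simp: S_def)
      have l: "0 < S / (c * D)" "S / (c * D) \<le> 1"
        using S D c \<open>\<not> c * D \<le> sqrt (2 * c * e)\<close> by (auto simp: S_def[symmetric] divide_le_eq_1)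
      have "e / (S / (c * D)) = S * D / 2" using S D c by (simp add: field_simps)
      moreover have "(1 - S / (c * D)) * (c / 2 * D\<^sup>2) = c / 2 * D\<^sup>2 - S * D / 2"
        using D c by (simp add: power2_eq_square field_simps)
      ultimately have "\<Phi> a p - \<Phi> b q + c / 2 * D\<^sup>2 \<le> S * D"
        using seg[OF l] by linarith
      then show ?thesis using e by (simp add: S_def)
    qed
  qed
  then show ?thesis by (simp add: D_def)
qed

section \<open>Perturbed descent of real sequences\<close>

lemma summable_if_summable_sqrt:
  fixes \<epsilon> :: "nat \<Rightarrow> real"
  assumes "summable (\<lambda>k. sqrt (\<epsilon> k))" "\<And>k. \<epsilon> k \<ge> 0"
  shows "summable \<epsilon>"
proof (rule summable_comparison_test_ev)
  have "\<forall>\<^sub>F k in sequentially. sqrt (\<epsilon> k) < 1"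
    using summable_LIMSEQ_zero[OF assms(1)] by (rule order_tendstoD) simp
  then show "\<forall>\<^sub>F k in sequentially. norm (\<epsilon> k) \<le> sqrt (\<epsilon> k)"
  proof eventually_elim
    case (elim k)
    then have "sqrt (\<epsilon> k) * sqrt (\<epsilon> k) \<le> sqrt (\<epsilon> k)"
      by (intro mult_left_le) (auto simp: assms)
    then show ?case using assms(2)[of k] by simp
  qed
qed (rule assms)

lemma tendsto_zero_if_square_norm_le:
  fixes v :: "nat \<Rightarrow> 'a::real_normed_vector"
  assumes "D \<longlonglongrightarrow> 0" "c > 0" "\<And>k. c * (norm (v k))\<^sup>2 \<le> D k"
  shows "v \<longlonglongrightarrow> 0"
proof -
  have "(\<lambda>k. c * (norm (v k))\<^sup>2) \<longlonglongrightarrow> 0"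
    by (rule tendsto_sandwich[OF _ _ tendsto_const assms(1)])
      (use assms in auto)
  from tendsto_mult_left[OF this, of "1 / c"] have "(\<lambda>k. (norm (v k))\<^sup>2) \<longlonglongrightarrow> 0"
    using assms(2) by simp
  from tendsto_real_sqrt[OF this] have "(\<lambda>k. norm (v k)) \<longlonglongrightarrow> 0" by simp
  then show ?thesis by (rule tendsto_norm_zero_cancel)
qed

text \<open>The perturbation is itself controlled by the sequence to be bounded.  At an index \<open>m\<close> where
  \<open>e\<close> is largest, the hypothesis becomes \<open>(e m)\<^sup>2 \<le> S + 2 * a * e m\<close>, whose positive
  root is the bound; feeding that back bounds \<open>T\<close>.\<close>

lemma quadratic_recursion_bound:
  fixes e T :: "nat \<Rightarrow> real"
  assumes rec: "\<And>n. n \<le> k \<Longrightarrow> (e n)\<^sup>2 + T n \<le> S + 2 * (\<Sum>j<n. \<alpha> j * e (Suc j))"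
    and nonneg: "\<And>n. e n \<ge> 0" "\<And>n. T n \<ge> 0" "\<And>j. \<alpha> j \<ge> 0" "S \<ge> 0"
  defines "a \<equiv> \<Sum>j<k. \<alpha> j"
  shows "e k \<le> a + sqrt (S + a\<^sup>2)" and "T k \<le> (a + sqrt (S + a\<^sup>2))\<^sup>2"
proof -
  have a: "a \<ge> 0" unfolding a_def by (intro sum_nonneg nonneg)
  define M where "M = Max (e ` {..k})"
  have M: "e n \<le> M" if "n \<le> k" for n using that unfolding M_def by (intro Max_ge) auto
  have "M \<in> e ` {..k}" unfolding M_def by (intro Max_in) auto
  then obtain m where m: "m \<le> k" "M = e m" by auto
  have sum_le: "(\<Sum>j<n. \<alpha> j * e (Suc j)) \<le> a * M" if "n \<le> k" for n
  proof -
    have "(\<Sum>j<n. \<alpha> j * e (Suc j)) \<le> (\<Sum>j<n. \<alpha> j * M)"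
      using that by (intro sum_mono mult_left_mono M nonneg) auto
    also have "\<dots> \<le> (\<Sum>j<k. \<alpha> j * M)"
      using that nonneg m by (intro sum_mono2) auto
    finally show ?thesis by (simp add: a_def sum_distrib_right)
  qed
  have "(e m)\<^sup>2 \<le> S + 2 * (a * M)"
    using rec[OF m(1)] sum_le[OF m(1)] nonneg(2)[of m] by linarith
  then have "M\<^sup>2 \<le> S + 2 * (a * M)" by (simp only: m(2))
  then have "(M - a)\<^sup>2 \<le> S + a\<^sup>2" by (simp add: power2_diff algebra_simps)
  then have "M - a \<le> sqrt (S + a\<^sup>2)" by (rule real_le_rsqrt)
  then have Mle: "M \<le> a + sqrt (S + a\<^sup>2)" by simp
  then show "e k \<le> a + sqrt (S + a\<^sup>2)" using M[of k] by linarith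
  have aM: "a * M \<le> a * (a + sqrt (S + a\<^sup>2))" using Mle a by (rule mult_left_mono)
  have "T k \<le> S + 2 * (a * M)"
    using rec[of k] sum_le[of k] by (smt (verit) le_refl zero_le_power2)
  also have "\<dots> \<le> (a + sqrt (S + a\<^sup>2))\<^sup>2"
    using aM nonneg(4) by (simp add: power2_sum) (simp add: algebra_simps power2_eq_square)
  finally show "T k \<le> (a + sqrt (S + a\<^sup>2))\<^sup>2" .
qed

text \<open>Subtracting the perturbations accumulated so far makes \<open>E\<close> decreasing and bounded below.\<close>

lemma perturbed_descent:
  fixes E D \<eta> :: "nat \<Rightarrow> real"
  assumes step: "\<And>k. E (Suc k) + D k \<le> E k + \<eta> k"
    and nonneg: "\<And>k. E k \<ge> 0" "\<And>k. D k \<ge> 0" "\<And>k. \<eta> k \<ge> 0" and summable: "summable \<eta>"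
  shows "convergent E" and "summable D"
proof -
  have sums: "E k + (\<Sum>j<k. D j) \<le> E 0 + (\<Sum>j<k. \<eta> j)" for k
    by (induction k) (auto, use step in \<open>smt (verit)\<close>)
  have \<eta>: "(\<Sum>j<k. \<eta> j) \<le> suminf \<eta>" for k
    using summable nonneg by (intro sum_le_suminf) auto
  show "summable D"
  proof (rule summableI_nonneg_bounded)
    show "(\<Sum>j<k. D j) \<le> E 0 + suminf \<eta>" for k
      using sums[of k] \<eta>[of k] nonneg(1)[of k] by linarith
  qed (rule nonneg)
  define F where "F k = E k - (\<Sum>j<k. \<eta> j)" for k
  have "decseq F"
    unfolding F_def by (intro decseq_SucI) (use step nonneg in \<open>smt (verit) sum.lessThan_Suc\<close>)
  moreover have "- suminf \<eta> \<le> F k" for k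
    using \<eta>[of k] nonneg(1)[of k] by (simp add: F_def)
  ultimately have "convergent F"
    by (metis decseq_convergent convergent_def)
  then have "convergent (\<lambda>k. F k + (\<Sum>j<k. \<eta> j))"
    using summable by (intro convergent_add) (auto simp: summable_iff_convergent)
  then show "convergent E" by (simp add: F_def)
qed

section \<open>The inexact primal-dual iteration\<close>

text \<open>This is the primal-dual method of Chambolle and Pock for the saddle function
  \<open>G z - inner z (K x) - H x\<close>, with primal step \<open>\<tau>\<close>, dual step \<open>\<rho>\<close> and extrapolated dual
  point \<open>z k + r k\<close>, recorded through the three-point inequalities of its two proximal steps; the
  primal one carries the errors.  \<open>H\<close> and \<open>G\<close> are real functions that matter only on the
  effective domains \<open>P\<close> and \<open>Q\<close>, which keeps infinite values out of the estimates.  The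
  initial point may lie outside the domains, and \<open>r 0\<close> is arbitrary, because an augmented Lagrangian
  method may start with any \<open>u 0\<close>.\<close>

locale inexact_primal_dual =
  fixes K :: "'a::euclidean_space \<Rightarrow> 'b::euclidean_space"
    and H :: "'a \<Rightarrow> real" and P :: "'a set" and G :: "'b \<Rightarrow> real" and Q :: "'b set"
    and N \<tau> \<rho> :: real and \<epsilon> :: "nat \<Rightarrow> real"
    and x :: "nat \<Rightarrow> 'a" and z r :: "nat \<Rightarrow> 'b"
  assumes linear_K: "linear K" and norm_K: "norm (K v) \<le> N * norm v"
    and \<tau>_pos: "\<tau> > 0" and \<rho>_pos: "\<rho> > 0" and step_sizes: "\<tau> * \<rho> * N\<^sup>2 < 1"
    and \<epsilon>_nonneg: "\<epsilon> k \<ge> 0"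
    and x_in: "x (Suc k) \<in> P" and z_in: "z (Suc k) \<in> Q"
    and x_step: "p \<in> P \<Longrightarrow> H (x (Suc k)) + inner (z k + r k) (K (x (Suc k) - p))
        + ((norm (x (Suc k) - x k))\<^sup>2 + (norm (p - x (Suc k)))\<^sup>2 - (norm (p - x k))\<^sup>2) / (2 * \<tau>)
      \<le> H p + \<epsilon> k + sqrt (2 * \<epsilon> k / \<tau>) * norm (p - x (Suc k))"
    and z_step: "q \<in> Q \<Longrightarrow> G (z (Suc k)) - inner (z (Suc k) - q) (K (x (Suc k)))
        + ((norm (z (Suc k) - z k))\<^sup>2 + (norm (q - z (Suc k)))\<^sup>2 - (norm (q - z k))\<^sup>2) / (2 * \<rho>)
      \<le> G q"
    and r_Suc: "r (Suc k) = z (Suc k) - z k"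
begin

text \<open>The saddle function at \<open>(z k, p)\<close> minus its value at \<open>(q, x k)\<close>.\<close>

definition gap :: "'b \<Rightarrow> 'a \<Rightarrow> nat \<Rightarrow> real" where
  "gap q p k = G (z k) - G q - inner (z k) (K p) + H (x k) - H p + inner q (K (x k))"

definition saddle :: "'b \<Rightarrow> 'a \<Rightarrow> bool" where
  "saddle q p \<longleftrightarrow> q \<in> Q \<and> p \<in> P \<and> (\<forall>p'\<in>P. H p - inner q (K (p' - p)) \<le> H p') \<and>
     (\<forall>q'\<in>Q. G q + inner (q' - q) (K p) \<le> G q')"

text \<open>The last two terms compensate for the extrapolation, which uses the previous dual increment
  \<open>r k\<close> in place of the next one.  The weight \<open>\<beta>\<close> says how much of the squared increment
  is kept in the energy instead of being released by the descent.\<close>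

definition energy :: "real \<Rightarrow> 'b \<Rightarrow> 'a \<Rightarrow> nat \<Rightarrow> real" where
  "energy \<beta> q p k = (norm (x k - p))\<^sup>2 / (2 * \<tau>) + (norm (z k - q))\<^sup>2 / (2 * \<rho>)
     + \<beta> * (norm (r k))\<^sup>2 / (2 * \<rho>) - inner (r k) (K (x k - p))"

lemma gap_nonneg: "saddle q p \<Longrightarrow> gap q p (Suc k) \<ge> 0"
  using x_in[of k] z_in[of k] unfolding saddle_def gap_def
  by (fastforce simp: linear_diff[OF linear_K] inner_diff_left inner_diff_right)

text \<open>Young's inequality, scaled so that the two squares come with the weights of the energy.\<close>

lemma coupling_le:
  assumes "\<beta> > 0"
  shows "\<bar>inner v (K w)\<bar>
    \<le> \<beta> * (norm v)\<^sup>2 / (2 * \<rho>) + \<tau> * \<rho> * N\<^sup>2 / \<beta> * (norm w)\<^sup>2 / (2 * \<tau>)"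
proof -
  have "\<bar>inner v (K w)\<bar> \<le> norm v * (N * norm w)"
    by (rule order_trans[OF Cauchy_Schwarz_ineq2]) (intro mult_left_mono norm_K norm_ge_zero)
  also have "\<dots> \<le> \<beta> * (norm v)\<^sup>2 / (2 * \<rho>) + \<rho> * N\<^sup>2 / \<beta> * (norm w)\<^sup>2 / 2"
  proof -
    have "0 \<le> (\<beta> * norm v - \<rho> * (N * norm w))\<^sup>2 / (2 * \<rho> * \<beta>)"
      using \<rho>_pos assms by simp
    also have "\<dots> = \<beta> * (norm v)\<^sup>2 / (2 * \<rho>) + \<rho> * N\<^sup>2 / \<beta> * (norm w)\<^sup>2 / 2
        - norm v * (N * norm w)"
      using \<rho>_pos assms by (simp add: power2_eq_square field_simps)
    finally show ?thesis by simp
  qed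
  also have "\<rho> * N\<^sup>2 / \<beta> * (norm w)\<^sup>2 / 2 = \<tau> * \<rho> * N\<^sup>2 / \<beta> * (norm w)\<^sup>2 / (2 * \<tau>)"
    using \<tau>_pos by simp
  finally show ?thesis .
qed

lemma energy_ge:
  assumes "\<beta> > 0"
  shows "(1 - \<tau> * \<rho> * N\<^sup>2 / \<beta>) * (norm (x k - p))\<^sup>2 / (2 * \<tau>) + (norm (z k - q))\<^sup>2 / (2 * \<rho>)
    \<le> energy \<beta> q p k"
  using coupling_le[OF assms, of "r k" "x k - p"] unfolding energy_def
  by (simp add: left_diff_distrib diff_divide_distrib abs_le_iff)

text \<open>Adding the two proximal inequalities leaves the bilinear term
  \<open>inner (r k - r (Suc k)) (K (x (Suc k) - p))\<close>.  Up to
  \<open>inner (r k) (K (x (Suc k) - x k))\<close> it telescopes into the last term of the energy, and the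
  remainder is absorbed by the squared increments.\<close>

lemma energy_descent:
  assumes "\<beta> > 0" "p \<in> P" "q \<in> Q"
  shows "gap q p (Suc k) + energy \<beta> q p (Suc k)
      + ((1 - \<tau> * \<rho> * N\<^sup>2 / \<beta>) * (norm (x (Suc k) - x k))\<^sup>2 / (2 * \<tau>)
         + (1 - \<beta>) * (norm (r (Suc k)))\<^sup>2 / (2 * \<rho>))
    \<le> energy \<beta> q p k + \<epsilon> k + sqrt (2 * \<epsilon> k / \<tau>) * norm (x (Suc k) - p)"
proof -
  have "gap q p (Suc k) + inner (z k + r k - z (Suc k)) (K (x (Suc k) - p))
      + ((norm (x (Suc k) - x k))\<^sup>2 + (norm (p - x (Suc k)))\<^sup>2 - (norm (p - x k))\<^sup>2) / (2 * \<tau>)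
      + ((norm (z (Suc k) - z k))\<^sup>2 + (norm (q - z (Suc k)))\<^sup>2 - (norm (q - z k))\<^sup>2) / (2 * \<rho>)
    \<le> \<epsilon> k + sqrt (2 * \<epsilon> k / \<tau>) * norm (p - x (Suc k))"
    using x_step[OF assms(2), of k] z_step[OF assms(3), of k] unfolding gap_def
    by (simp add: linear_diff[OF linear_K] inner_diff_left inner_diff_right inner_add_left)
  moreover have "inner (z k + r k - z (Suc k)) (K (x (Suc k) - p))
      = inner (r k) (K (x k - p)) + inner (r k) (K (x (Suc k) - x k))
        - inner (r (Suc k)) (K (x (Suc k) - p))"
    unfolding r_Suc
    by (simp add: linear_diff[OF linear_K] inner_diff_left inner_diff_right inner_add_left)
  moreover have "- inner (r k) (K (x (Suc k) - x k))
      \<le> \<beta> * (norm (r k))\<^sup>2 / (2 * \<rho>)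
        + \<tau> * \<rho> * N\<^sup>2 / \<beta> * (norm (x (Suc k) - x k))\<^sup>2 / (2 * \<tau>)"
    using coupling_le[OF assms(1), of "r k" "x (Suc k) - x k"] by (simp add: abs_le_iff)
  ultimately show ?thesis
    unfolding energy_def
    by (simp add: left_diff_distrib diff_divide_distrib add_divide_distrib
        norm_minus_commute[of p] norm_minus_commute[of q] r_Suc[symmetric])
qed

text \<open>Weight 1 on the last dual increment leaves nothing of it in the descent and, in exchange, the
  largest possible share of the primal distance in the lower bound of the energy.\<close>

lemma energy_recursion:
  assumes "saddle q p"
  defines "\<kappa> \<equiv> 1 - \<tau> * \<rho> * N\<^sup>2"
  defines "e \<equiv> \<lambda>k. sqrt (\<kappa> / (2 * \<tau>)) * norm (x k - p)"
  shows "(e k)\<^sup>2 + (\<Sum>j<k. gap q p (Suc j))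
    \<le> energy 1 q p 0 + (\<Sum>j<k. \<epsilon> j) + 2 * (\<Sum>j<k. sqrt (\<epsilon> j / \<kappa>) * e (Suc j))"
proof -
  have \<kappa>: "\<kappa> > 0" using step_sizes by (simp add: \<kappa>_def)
  have err: "sqrt (2 * \<epsilon> j / \<tau>) * norm (x (Suc j) - p) = 2 * (sqrt (\<epsilon> j / \<kappa>) * e (Suc j))" for j
  proof -
    have "2 * \<epsilon> j / \<tau> = 2\<^sup>2 * ((\<epsilon> j / \<kappa>) * (\<kappa> / (2 * \<tau>)))"
      using \<kappa> \<tau>_pos by (simp add: field_simps)
    then have "sqrt (2 * \<epsilon> j / \<tau>) = 2 * (sqrt (\<epsilon> j / \<kappa>) * sqrt (\<kappa> / (2 * \<tau>)))"
      by (simp only: real_sqrt_mult real_sqrt_power) simp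
    then show ?thesis by (simp add: e_def)
  qed
  have "energy 1 q p n + (\<Sum>j<n. gap q p (Suc j))
    \<le> energy 1 q p 0 + (\<Sum>j<n. \<epsilon> j) + 2 * (\<Sum>j<n. sqrt (\<epsilon> j / \<kappa>) * e (Suc j))" for n
  proof (induction n)
    case (Suc n)
    have "0 \<le> \<kappa> * (norm (x (Suc n) - x n))\<^sup>2 / (2 * \<tau>)" using \<kappa> \<tau>_pos by simp
    then have "gap q p (Suc n) + energy 1 q p (Suc n)
        \<le> energy 1 q p n + \<epsilon> n + 2 * (sqrt (\<epsilon> n / \<kappa>) * e (Suc n))"
      using energy_descent[of 1 p q n] assms(1) err[of n] by (simp add: saddle_def \<kappa>_def)
    then show ?case using Suc by (simp add: distrib_left)
  qed simp
  moreover have "(e k)\<^sup>2 \<le> energy 1 q p k"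
  proof -
    have "0 \<le> (norm (z k - q))\<^sup>2 / (2 * \<rho>)" using \<rho>_pos by simp
    moreover have "(e k)\<^sup>2 = \<kappa> * (norm (x k - p))\<^sup>2 / (2 * \<tau>)"
      using \<kappa> \<tau>_pos by (simp add: e_def power_mult_distrib)
    ultimately show ?thesis using energy_ge[of 1 k p q] by (simp add: \<kappa>_def)
  qed
  ultimately show ?thesis by (smt (verit))
qed

lemma energy_nonneg:
  assumes "\<tau> * \<rho> * N\<^sup>2 \<le> \<beta>" "\<beta> > 0"
  shows "energy \<beta> q p k \<ge> 0"
proof -
  have "\<tau> * \<rho> * N\<^sup>2 / \<beta> \<le> 1" using assms by simp
  then have "0 \<le> (1 - \<tau> * \<rho> * N\<^sup>2 / \<beta>) * (norm (x k - p))\<^sup>2 / (2 * \<tau>) + (norm (z k - q))\<^sup>2 / (2 * \<rho>)"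
    using \<tau>_pos \<rho>_pos by simp
  then show ?thesis using energy_ge[OF assms(2)] by (rule order_trans)
qed

text \<open>The constant comes from \<open>a + sqrt (C\<^sup>2 + b + a\<^sup>2) \<le> C + 2 * a + sqrt b\<close>, where
  \<open>a\<close> and \<open>b\<close> are the two error sums.\<close>

lemma gap_sum_le:
  assumes "saddle q p" and C: "energy 1 q p 0 \<le> C\<^sup>2" "C \<ge> 0"
  shows "(\<Sum>j<k. gap q p (Suc j))
    \<le> (C + 2 * (\<Sum>j<k. sqrt (\<epsilon> j / (1 - \<tau> * \<rho> * N\<^sup>2))) + sqrt (\<Sum>j<k. \<epsilon> j))\<^sup>2"
proof -
  define \<kappa> where "\<kappa> = 1 - \<tau> * \<rho> * N\<^sup>2"
  define e where "e k = sqrt (\<kappa> / (2 * \<tau>)) * norm (x k - p)" for k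
  define a b where "a = (\<Sum>j<k. sqrt (\<epsilon> j / \<kappa>))" and "b = (\<Sum>j<k. \<epsilon> j)"
  have \<kappa>: "\<kappa> > 0" using step_sizes by (simp add: \<kappa>_def)
  have ab: "a \<ge> 0" "b \<ge> 0"
    unfolding a_def b_def using \<kappa> by (auto intro!: sum_nonneg simp: \<epsilon>_nonneg)
  have "(\<Sum>j<k. gap q p (Suc j)) \<le> (a + sqrt ((C\<^sup>2 + b) + a\<^sup>2))\<^sup>2"
    unfolding a_def
  proof (rule quadratic_recursion_bound(2)[where e = e])
    show "(e n)\<^sup>2 + (\<Sum>j<n. gap q p (Suc j))
      \<le> (C\<^sup>2 + b) + 2 * (\<Sum>j<n. sqrt (\<epsilon> j / \<kappa>) * e (Suc j))" if "n \<le> k" for n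
    proof -
      have "(\<Sum>j<n. \<epsilon> j) \<le> b"
        unfolding b_def using that by (intro sum_mono2) (auto simp: \<epsilon>_nonneg)
      then show ?thesis
        using energy_recursion[OF assms(1), of n] C(1) by (simp add: e_def \<kappa>_def)
    qed
  qed (use \<kappa> \<tau>_pos ab in \<open>auto intro!: sum_nonneg gap_nonneg assms(1) simp: e_def \<epsilon>_nonneg\<close>)
  also have "\<dots> \<le> (C + 2 * a + sqrt b)\<^sup>2"
  proof (rule power_mono)
    have "sqrt (C\<^sup>2 + b + a\<^sup>2) \<le> C + sqrt b + a"
    proof (rule real_le_lsqrt)
      have "(C + sqrt b + a)\<^sup>2 = C\<^sup>2 + b + a\<^sup>2 + 2 * (C * sqrt b + C * a + sqrt b * a)"
        using ab by (simp add: power2_eq_square algebra_simps)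
      moreover have "0 \<le> C * sqrt b + C * a + sqrt b * a" using ab C by simp
      ultimately show "C\<^sup>2 + b + a\<^sup>2 \<le> (C + sqrt b + a)\<^sup>2" by simp
    qed (use ab C in auto)
    then show "a + sqrt (C\<^sup>2 + b + a\<^sup>2) \<le> C + 2 * a + sqrt b" by simp
  qed (use ab in auto)
  finally show ?thesis by (simp add: a_def b_def \<kappa>_def)
qed

lemma x_bounded:
  assumes "saddle q p" and sqrt_summable: "summable (\<lambda>k. sqrt (\<epsilon> k))"
  obtains B where "B \<ge> 0" "\<And>k. norm (x k - p) \<le> B"
proof -
  define \<kappa> where "\<kappa> = 1 - \<tau> * \<rho> * N\<^sup>2"
  define c where "c = sqrt (\<kappa> / (2 * \<tau>))"
  define e where "e k = c * norm (x k - p)" for k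
  define S where "S = energy 1 q p 0 + suminf \<epsilon>"
  define \<alpha> where "\<alpha> j = sqrt (\<epsilon> j / \<kappa>)" for j
  have \<kappa>: "\<kappa> > 0" using step_sizes by (simp add: \<kappa>_def)
  have c: "c > 0" using \<kappa> \<tau>_pos by (simp add: c_def)
  note \<epsilon>_summable = summable_if_summable_sqrt[OF sqrt_summable \<epsilon>_nonneg]
  have \<alpha>: "summable \<alpha>" "\<alpha> j \<ge> 0" for j
    using summable_divide[OF sqrt_summable, of "sqrt \<kappa>"] \<kappa>
    by (auto simp: \<alpha>_def[abs_def] real_sqrt_divide \<epsilon>_nonneg)
  have S: "S \<ge> 0"
    using energy_nonneg[of 1 q p 0] step_sizes suminf_nonneg[OF \<epsilon>_summable \<epsilon>_nonneg]
    by (simp add: S_def)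
  have "e k \<le> suminf \<alpha> + sqrt (S + (suminf \<alpha>)\<^sup>2)" for k
  proof -
    have "e k \<le> (\<Sum>j<k. \<alpha> j) + sqrt (S + (\<Sum>j<k. \<alpha> j)\<^sup>2)"
    proof (rule quadratic_recursion_bound(1))
      show "(e n)\<^sup>2 + (\<Sum>j<n. gap q p (Suc j)) \<le> S + 2 * (\<Sum>j<n. \<alpha> j * e (Suc j))" for n
        using energy_recursion[OF assms(1), of n] sum_le_suminf[OF \<epsilon>_summable, of "{..<n}"]
        by (simp add: e_def c_def \<kappa>_def \<alpha>_def S_def \<epsilon>_nonneg)
    qed (use c S \<alpha> in \<open>auto intro!: sum_nonneg gap_nonneg assms(1) simp: e_def\<close>)
    also have "\<dots> \<le> suminf \<alpha> + sqrt (S + (suminf \<alpha>)\<^sup>2)"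
      by (intro add_mono real_sqrt_le_mono power_mono sum_le_suminf sum_nonneg \<alpha> order_refl) auto
    finally show ?thesis .
  qed
  then have *: "norm (x k - p) \<le> (suminf \<alpha> + sqrt (S + (suminf \<alpha>)\<^sup>2)) / c" for k
    using c by (simp add: e_def field_simps)
  moreover have "0 \<le> (suminf \<alpha> + sqrt (S + (suminf \<alpha>)\<^sup>2)) / c"
    using *[of 0] norm_ge_zero order_trans by blast
  ultimately show thesis using that by blast
qed

lemma midway_weight:
  "0 < (1 + \<tau> * \<rho> * N\<^sup>2) / 2" "\<tau> * \<rho> * N\<^sup>2 < (1 + \<tau> * \<rho> * N\<^sup>2) / 2" "(1 + \<tau> * \<rho> * N\<^sup>2) / 2 < 1"
proof -
  define c where "c = \<tau> * \<rho> * N\<^sup>2"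
  have "0 \<le> c" "c < 1" using \<tau>_pos \<rho>_pos step_sizes by (auto simp: c_def)
  then have "0 < (1 + c) / 2" "c < (1 + c) / 2" "(1 + c) / 2 < 1" by auto
  then show "0 < (1 + \<tau> * \<rho> * N\<^sup>2) / 2" "\<tau> * \<rho> * N\<^sup>2 < (1 + \<tau> * \<rho> * N\<^sup>2) / 2"
    "(1 + \<tau> * \<rho> * N\<^sup>2) / 2 < 1" unfolding c_def .
qed

text \<open>A weight halfway between the coupling constant and 1 leaves a positive multiple of both
  squared increments in the descent.\<close>

lemma energy_convergent:
  assumes "saddle q p" and sqrt_summable: "summable (\<lambda>k. sqrt (\<epsilon> k))"
  defines "\<beta> \<equiv> (1 + \<tau> * \<rho> * N\<^sup>2) / 2"
  shows "convergent (energy \<beta> q p)" and "(\<lambda>k. x (Suc k) - x k) \<longlonglongrightarrow> 0" and "r \<longlonglongrightarrow> 0"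
proof -
  obtain B where B: "B \<ge> 0" "\<And>k. norm (x k - p) \<le> B"
    using x_bounded[OF assms(1,2)] by blast
  define c where "c = (1 - \<tau> * \<rho> * N\<^sup>2 / \<beta>) / (2 * \<tau>)"
  define c' where "c' = (1 - \<beta>) / (2 * \<rho>)"
  define D where "D k = c * (norm (x (Suc k) - x k))\<^sup>2 + c' * (norm (r (Suc k)))\<^sup>2" for k
  define \<eta> where "\<eta> k = \<epsilon> k + B * (sqrt (2 / \<tau>) * sqrt (\<epsilon> k))" for k
  note \<beta> = midway_weight[folded \<beta>_def]
  have c: "c > 0" "c' > 0" using \<beta> \<tau>_pos \<rho>_pos by (auto simp: c_def c'_def)
  have step: "energy \<beta> q p (Suc k) + D k \<le> energy \<beta> q p k + \<eta> k" for k
  proof -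
    have "sqrt (2 * \<epsilon> k / \<tau>) * norm (x (Suc k) - p) \<le> sqrt (2 * \<epsilon> k / \<tau>) * B"
      using \<tau>_pos \<epsilon>_nonneg[of k] by (intro mult_left_mono B) auto
    also have "\<dots> = B * (sqrt (2 / \<tau>) * sqrt (\<epsilon> k))"
      by (simp flip: real_sqrt_mult)
    finally show ?thesis
      using energy_descent[OF \<beta>(1), of p q k] gap_nonneg[OF assms(1), of k] assms(1)
      by (simp add: D_def \<eta>_def c_def c'_def saddle_def)
  qed
  have D: "D k \<ge> 0" for k using c by (simp add: D_def)
  have E: "energy \<beta> q p k \<ge> 0" for k using \<beta> by (intro energy_nonneg) auto
  have \<eta>: "\<eta> k \<ge> 0" for k using B(1) \<tau>_pos by (simp add: \<eta>_def \<epsilon>_nonneg)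
  have \<eta>_summable: "summable \<eta>"
    unfolding \<eta>_def
    by (intro summable_add summable_mult sqrt_summable
        summable_if_summable_sqrt[OF sqrt_summable \<epsilon>_nonneg])
  show "convergent (energy \<beta> q p)"
    using perturbed_descent(1)[of "energy \<beta> q p" D \<eta>] step E D \<eta> \<eta>_summable by blast
  have D_summable: "summable D"
    using perturbed_descent(2)[of "energy \<beta> q p" D \<eta>] step E D \<eta> \<eta>_summable by blast
  show "(\<lambda>k. x (Suc k) - x k) \<longlonglongrightarrow> 0"
    by (rule tendsto_zero_if_square_norm_le[OF summable_LIMSEQ_zero[OF D_summable] c(1)]) (use c in \<open>simp add: D_def\<close>)
  have "(\<lambda>k. r (Suc k)) \<longlonglongrightarrow> 0"
    by (rule tendsto_zero_if_square_norm_le[OF summable_LIMSEQ_zero[OF D_summable] c(2)]) (use c in \<open>simp add: D_def\<close>)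
  then show "r \<longlonglongrightarrow> 0" by (rule LIMSEQ_imp_Suc)
qed

text \<open>Opial's argument: the iterates are bounded, hence have a limit point.  The energy may then be
  taken relative to that limit point, and forces the whole sequence towards it.\<close>

lemma convergence:
  assumes "saddle q p" and sqrt_summable: "summable (\<lambda>k. sqrt (\<epsilon> k))"
    and limit_points: "\<And>s q' p'. strict_mono s \<Longrightarrow> (\<lambda>k. z (s k)) \<longlonglongrightarrow> q' \<Longrightarrow> (\<lambda>k. x (s k)) \<longlonglongrightarrow> p' \<Longrightarrow> saddle q' p'"
  obtains q' p' where "saddle q' p'" "z \<longlonglongrightarrow> q'" "x \<longlonglongrightarrow> p'"
proof -
  define \<beta> where "\<beta> = (1 + \<tau> * \<rho> * N\<^sup>2) / 2"
  define c where "c = (1 - \<tau> * \<rho> * N\<^sup>2 / \<beta>) / (2 * \<tau>)"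
  note \<beta> = midway_weight[folded \<beta>_def]
  have c: "c > 0" using \<beta> \<tau>_pos by (auto simp: c_def)
  have low: "c * (norm (x k - p'))\<^sup>2 + (norm (z k - q'))\<^sup>2 / (2 * \<rho>) \<le> energy \<beta> q' p' k" for q' p' k
    using energy_ge[OF \<beta>(1)] by (simp add: c_def)
  obtain B where B: "\<And>k. norm (x k - p) \<le> B"
    using x_bounded[OF assms(1,2)] by blast
  have "convergent (energy \<beta> q p)"
    using energy_convergent(1)[OF assms(1,2)] by (simp add: \<beta>_def)
  then have "Bseq (energy \<beta> q p)" by (rule convergent_imp_Bseq)
  then obtain M where M: "\<And>k. norm (energy \<beta> q p k) \<le> M" by (auto simp: Bseq_def)
  have "norm (z k - q) \<le> sqrt (2 * \<rho> * M)" for k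
  proof (rule real_le_rsqrt)
    have "0 \<le> c * (norm (x k - p))\<^sup>2" using c by simp
    then have "(norm (z k - q))\<^sup>2 / (2 * \<rho>) \<le> M" using low[of k p q] M[of k] by simp
    then show "(norm (z k - q))\<^sup>2 \<le> 2 * \<rho> * M" using \<rho>_pos by (simp add: field_simps)
  qed
  then have "(z k, x k) \<in> cball q (sqrt (2 * \<rho> * M)) \<times> cball p B" for k
    using B by (simp add: dist_norm norm_minus_commute)
  then have "bounded (range (\<lambda>k. (z k, x k)))"
    by (intro bounded_subset[OF bounded_Times[OF bounded_cball bounded_cball]]) blast
  then obtain w s where s: "strict_mono s" and lim: "(\<lambda>k. (z (s k), x (s k))) \<longlonglongrightarrow> w"
    using bounded_imp_convergent_subsequence unfolding o_def by blast
  obtain q' p' where w: "w = (q', p')" by (cases w)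
  have zs: "(\<lambda>k. z (s k)) \<longlonglongrightarrow> q'" and xs: "(\<lambda>k. x (s k)) \<longlonglongrightarrow> p'"
    using tendsto_fst[OF lim] tendsto_snd[OF lim] by (simp_all add: w)
  have saddle: "saddle q' p'" using s zs xs by (rule limit_points)
  have rs: "(\<lambda>k. r (s k)) \<longlonglongrightarrow> 0"
    using LIMSEQ_subseq_LIMSEQ[OF energy_convergent(3)[OF assms(1,2)] s] by (simp add: o_def)
  have K_cont: "(\<lambda>k. K (x (s k) - p')) \<longlonglongrightarrow> K (p' - p')"
    by (rule bounded_linear.tendsto[OF linear_conv_bounded_linear[THEN iffD1, OF linear_K]
        tendsto_diff[OF xs tendsto_const]])
  \<comment> \<open>The energy relative to the limit point converges, and along the subsequence it tends to 0.\<close>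
  have "(\<lambda>k. energy \<beta> q' p' (s k)) \<longlonglongrightarrow> (norm (p' - p'))\<^sup>2 / (2 * \<tau>) + (norm (q' - q'))\<^sup>2 / (2 * \<rho>)
     + \<beta> * (norm (0::'b))\<^sup>2 / (2 * \<rho>) - inner 0 (K (p' - p'))"
    unfolding energy_def using \<tau>_pos \<rho>_pos by (intro tendsto_intros zs xs rs K_cont) auto
  then have "(\<lambda>k. energy \<beta> q' p' (s k)) \<longlonglongrightarrow> 0" by simp
  moreover obtain l where l: "energy \<beta> q' p' \<longlonglongrightarrow> l"
    using energy_convergent(1)[OF saddle assms(2)] by (auto simp: \<beta>_def convergent_def)
  ultimately have "l = 0"
    using LIMSEQ_unique[OF LIMSEQ_subseq_LIMSEQ[OF l s, unfolded o_def]] by blast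
  with l have lim0: "energy \<beta> q' p' \<longlonglongrightarrow> 0" by simp
  have "x \<longlonglongrightarrow> p'"
  proof (rule LIM_zero_cancel, rule tendsto_zero_if_square_norm_le[OF lim0 c])
    show "c * (norm (x k - p'))\<^sup>2 \<le> energy \<beta> q' p' k" for k
      using low[of k p' q'] \<rho>_pos by (smt (verit) divide_nonneg_pos zero_le_power2)
  qed
  moreover have "z \<longlonglongrightarrow> q'"
  proof (rule LIM_zero_cancel, rule tendsto_zero_if_square_norm_le[OF lim0])
    show "1 / (2 * \<rho>) * (norm (z k - q'))\<^sup>2 \<le> energy \<beta> q' p' k" for k
    proof -
      have "0 \<le> c * (norm (x k - p'))\<^sup>2" using c by simp
      then show ?thesis using low[of k p' q'] by simp
    qed
  qed (use \<rho>_pos in simp)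
  ultimately show thesis using saddle that by blast
qed

end

section \<open>Saddle points and optimality conditions\<close>

lemma inner_transpose: "inner (transpose A *v q) p = inner q (A *v p)"
  for A :: "real^'n^'m"
  by (simp add: dot_lmul_matrix)

text \<open>Both optimality conditions are subgradient inequalities for \<open>g\<close> and \<open>h\<close> themselves.  Stated with
  \<open>A *v p\<close> as a subgradient of the conjugate of \<open>g\<close> instead, the one for \<open>g\<close> would only yield
  optimality of \<open>p\<close> for the dual problem by way of the biconjugate.\<close>

lemma saddle_point_solution_if_subgradients:
  fixes A :: "real^'n^'m"
  assumes g: "closed_proper_convex g" and h: "closed_proper_convex h"
    and sub_h: "subgradient h p (- (transpose A *v q))" and sub_g: "subgradient g (A *v p) q"
  shows "saddle_point_solution A g h q p"
proof -
  define a b where "a = real_of_ereal (h p)" and "b = real_of_ereal (g (A *v p))"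
  have a: "h p = ereal a" and b: "g (A *v p) = ereal b"
    using subgradientD(1)[OF sub_h] subgradientD(1)[OF sub_g] by (simp_all add: a_def b_def)
  have conj_g: "convex_conjugate g q = ereal (inner q (A *v p) - b)"
    using conjugate_at_subgradient[OF sub_g] by (simp add: b_def)
  have conj_h: "convex_conjugate h (- (transpose A *v q)) = ereal (- inner q (A *v p) - a)"
    using conjugate_at_subgradient[OF sub_h] by (simp add: a_def dot_lmul_matrix)
  have h_ge: "ereal (a - inner q (A *v (p' - p))) \<le> h p'" for p'
    using sub_h a by (auto simp: subgradient_def dot_lmul_matrix)
  have g_ge: "ereal (b + inner q (A *v (p' - p))) \<le> g (A *v p')" for p'
    using sub_g b by (auto simp: subgradient_def matrix_vector_mult_diff_distrib)
  have "saddle_point (Omega A g h) q p"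
    unfolding saddle_point_def
  proof (intro conjI allI)
    fix p' show "Omega A g h q p' \<le> Omega A g h q p"
      using h_ge[of p'] by (cases "h p'")
        (auto simp: Omega_def conj_g a dot_lmul_matrix matrix_vector_mult_diff_distrib
          inner_diff_right)
  next
    fix q' show "Omega A g h q p \<le> Omega A g h q' p"
      using fenchel_young[where f = g, OF b, of q'] by (cases "convex_conjugate g q'")
        (auto simp: Omega_def conj_g a dot_lmul_matrix)
  qed
  moreover have "is_arg_min (primal_objective A g h) (\<lambda>_. True) q"
  proof -
    have "primal_objective A g h q \<le> primal_objective A g h q'" for q'
    proof -
      have "primal_objective A g h q
          = ereal (inner (- (transpose A *v q')) p - a) + ereal (inner q' (A *v p) - b)"
        unfolding primal_objective_def conj_g conj_h by (simp add: dot_lmul_matrix)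
      also have "\<dots> \<le> primal_objective A g h q'"
        unfolding primal_objective_def by (intro add_mono fenchel_young a b)
      finally show ?thesis .
    qed
    then show ?thesis by (auto simp: is_arg_min_def not_less)
  qed
  moreover have "is_arg_max (dual_objective A g h) (\<lambda>_. True) p"
  proof -
    have "dual_objective A g h p' \<le> dual_objective A g h p" for p'
      using h_ge[of p'] g_ge[of p']
      by (cases "h p'"; cases "g (A *v p')") (auto simp: dual_objective_def a b)
    then show ?thesis by (auto simp: is_arg_max_def not_less)
  qed
  ultimately show ?thesis by (simp add: saddle_point_solution_def)
qed

text \<open>A point \<open>q1\<close> with finite conjugate rules out the degenerate saddle points at which the
  convention \<open>\<infinity> - \<infinity> = \<infinity>\<close> would decide the value of the saddle function.\<close>

lemma saddle_pointD:
  fixes A :: "real^'n^'m"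
  assumes g: "closed_proper_convex g" and h: "closed_proper_convex h"
    and q1: "convex_conjugate g q1 \<noteq> \<infinity>" and saddle: "saddle_point (Omega A g h) q p"
  shows "h p \<noteq> \<infinity>" and "convex_conjugate g q \<noteq> \<infinity>"
    and "h p' \<noteq> \<infinity> \<Longrightarrow> real_of_ereal (h p) - inner q (A *v (p' - p)) \<le> real_of_ereal (h p')"
    and "convex_conjugate g q' \<noteq> \<infinity> \<Longrightarrow> real_of_ereal (convex_conjugate g q)
      + inner (q' - q) (A *v p) \<le> real_of_ereal (convex_conjugate g q')"
proof -
  have max: "Omega A g h q p' \<le> Omega A g h q p" and min: "Omega A g h q p \<le> Omega A g h q' p"
    for p' q' using saddle by (auto simp: saddle_point_def)
  have h_MInf: "h v \<noteq> -\<infinity>" for v using h by (simp add: closed_proper_convex_def)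
  obtain c where c: "convex_conjugate g q1 = ereal c"
    using q1 conjugate_not_MInf[OF g, of q1] by (cases "convex_conjugate g q1") auto
  show "h p \<noteq> \<infinity>"
  proof
    assume "h p = \<infinity>"
    then have "Omega A g h q1 p = -\<infinity>" by (simp add: Omega_def c)
    then have MInf: "Omega A g h q p' = -\<infinity>" for p'
      using max[of p'] min[of q1] by auto
    obtain p1 where "h p1 \<noteq> \<infinity>" using h by (rule closed_proper_convex_domain)
    then obtain e where "h p1 = ereal e" using closed_proper_convex_finite[OF h] by metis
    then show False
      using MInf[of p1] conjugate_not_MInf[OF g, of q]
      by (cases "convex_conjugate g q") (auto simp: Omega_def)
  qed
  then obtain a where a: "h p = ereal a" using closed_proper_convex_finite[OF h] by metis
  show "convex_conjugate g q \<noteq> \<infinity>"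
    using min[of q1] by (auto simp: Omega_def a c)
  then obtain b where b: "convex_conjugate g q = ereal b"
    using conjugate_not_MInf[OF g, of q] by (cases "convex_conjugate g q") auto
  show "real_of_ereal (h p) - inner q (A *v (p' - p)) \<le> real_of_ereal (h p')" if "h p' \<noteq> \<infinity>"
    using max[of p'] that h_MInf[of p'] a b
    by (cases "h p'") (auto simp: Omega_def dot_lmul_matrix matrix_vector_mult_diff_distrib
        inner_diff_right)
  show "real_of_ereal (convex_conjugate g q) + inner (q' - q) (A *v p)
      \<le> real_of_ereal (convex_conjugate g q')" if "convex_conjugate g q' \<noteq> \<infinity>"
    using min[of q'] that conjugate_not_MInf[OF g, of q'] a b
    by (cases "convex_conjugate g q'") (auto simp: Omega_def dot_lmul_matrix inner_diff_left)
qed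

section \<open>The augmented Lagrangian updates\<close>

lemma gradient_theta:
  "gradient (theta A \<rho> u d) p = \<rho> *\<^sub>R (transpose A *v (A *v p - u - d))"
proof -
  let ?D = "\<rho> *\<^sub>R (transpose A *v (A *v p - u - d))"
  have "((\<lambda>p. \<rho> / 2 * inner (A *v p - u - d) (A *v p - u - d)) has_derivative
      (\<lambda>v. \<rho> / 2 * (inner (A *v p - u - d) (A *v v) + inner (A *v v) (A *v p - u - d)))) (at p)"
    by (auto intro!: derivative_eq_intros
        bounded_linear.has_derivative[OF matrix_vector_mul_bounded_linear])
  moreover have "\<rho> / 2 * (inner (A *v p - u - d) (A *v v) + inner (A *v v) (A *v p - u - d))
      = inner v ?D" for v
    using inner_transpose[of A "A *v p - u - d" v] unfolding inner_scaleR_right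
    by (simp only: inner_commute[of v] inner_commute[of "A *v v"]) simp
  ultimately have deriv: "GDERIV (theta A \<rho> u d) p :> ?D"
    unfolding gderiv_def theta_def[abs_def] power2_norm_eq_inner by (simp only:)
  then show ?thesis
    unfolding gradient_def
  proof (rule the_equality)
    fix D assume "GDERIV (theta A \<rho> u d) p :> D"
    then have "(\<lambda>v. inner v D) = (\<lambda>v. inner v ?D)"
      using deriv unfolding gderiv_def by (rule has_derivative_unique)
    from fun_cong[OF this, of "D - ?D"] have "inner (D - ?D) (D - ?D) = 0"
      by (simp only: inner_diff_right[of "D - ?D"] diff_self)
    then show "D = ?D" by simp
  qed
qed

text \<open>A bound on the absolute difference excludes an infinite value as well as an infinite infimum,
  since each of them would make the difference infinite.\<close>

lemma approximate_infimumD: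
  fixes F :: "'a \<Rightarrow> ereal"
  assumes "\<bar>F p - (INF v. F v)\<bar> \<le> ereal e" "F q \<noteq> \<infinity>"
  shows "\<bar>F p\<bar> \<noteq> \<infinity>" and "F p \<le> F v + ereal e"
proof -
  have Inf: "(INF v. F v) \<le> F w" for w by (rule INF_lower) simp
  then obtain m where m: "(INF v. F v) = ereal m"
    using assms Inf[of q] by (cases "INF v. F v"; cases "F p") auto
  then obtain a where a: "F p = ereal a" using assms(1) by (cases "F p") auto
  then show "\<bar>F p\<bar> \<noteq> \<infinity>" by simp
  show "F p \<le> F v + ereal e"
    using assms(1) Inf[of v] by (cases "F v") (auto simp: m a)
qed

text \<open>The error-free case of the inequality for approximate proximal points, with the square
  expanded.\<close>

lemma subgradient_if_prox:
  fixes f :: "'a::euclidean_space \<Rightarrow> ereal"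
  assumes f: "closed_proper_convex f" and c: "c > 0"
    and min: "is_arg_min (\<lambda>v. f v + ereal (c / 2 * (norm (w - v))\<^sup>2)) (\<lambda>_. True) p"
  shows "subgradient f p (c *\<^sub>R (w - p))"
proof -
  have le: "f p + ereal (c / 2 * (norm (w - p))\<^sup>2) \<le> f v + ereal (c / 2 * (norm (w - v))\<^sup>2)" for v
    using min by (auto simp: is_arg_min_def not_less)
  obtain p1 where "f p1 \<noteq> \<infinity>" using f by (rule closed_proper_convex_domain)
  then have fin: "f p \<noteq> \<infinity>" using le[of p1] by auto
  obtain a where a: "f p = ereal a" using closed_proper_convex_finite[OF f fin] by metis
  have "f p + ereal (inner (c *\<^sub>R (w - p)) (q - p)) \<le> f q" for q
  proof (cases "f q = \<infinity>")
    case False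
    then obtain b where b: "f q = ereal b" using closed_proper_convex_finite[OF f] by metis
    have "a + inner 0 p + c / 2 * (norm (p - w))\<^sup>2 + c / 2 * (norm (q - p))\<^sup>2
        \<le> b + inner 0 q + c / 2 * (norm (q - w))\<^sup>2 + 0 + sqrt (2 * c * 0) * norm (q - p)"
    proof (rule approximate_prox_inequality[OF _ c _ a b])
      show "a + inner 0 p + c / 2 * (norm (p - w))\<^sup>2 \<le> b' + inner 0 v + c / 2 * (norm (v - w))\<^sup>2 + 0"
        if "f v \<le> ereal b'" for v b'
      proof -
        have "ereal (a + c / 2 * (norm (w - p))\<^sup>2) \<le> f v + ereal (c / 2 * (norm (w - v))\<^sup>2)"
          using le[of v] a by simp
        also have "\<dots> \<le> ereal (b' + c / 2 * (norm (w - v))\<^sup>2)"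
          using add_right_mono[OF that, of "ereal (c / 2 * (norm (w - v))\<^sup>2)"] by simp
        finally show ?thesis by (simp add: norm_minus_commute)
      qed
    qed (use f in \<open>auto simp: closed_proper_convex_def\<close>)
    moreover have "(norm (q - w))\<^sup>2
        = (norm (p - w))\<^sup>2 + (norm (q - p))\<^sup>2 - 2 * inner (w - p) (q - p)"
      unfolding power2_norm_eq_inner
      by (simp add: inner_diff_left inner_diff_right inner_commute)
    ultimately show ?thesis
      using a b by (simp add: algebra_simps)
  qed simp
  then show ?thesis using a by (simp add: subgradient_def)
qed

locale inexact_linearized_ALM =
  fixes A :: "real^'n^'m" and g :: "real^'m \<Rightarrow> ereal" and h :: "real^'n \<Rightarrow> ereal"
    and \<rho> L t :: real and \<epsilon> :: "nat \<Rightarrow> real"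
    and x :: "nat \<Rightarrow> real^'n" and u d :: "nat \<Rightarrow> real^'m"
  assumes g: "closed_proper_convex g" and h: "closed_proper_convex h"
    and \<rho>: "\<rho> > 0" and L: "L > (spectral_norm A)\<^sup>2" and t: "t = 1 / L"
    and \<epsilon>_nonneg: "\<And>k. \<epsilon> k \<ge> 0"
    and iterates: "inexact_LALM A g h \<rho> L \<epsilon> x u d"
begin

text \<open>The translation into a primal-dual iteration: \<open>r k\<close> is the last dual increment when
  \<open>k > 0\<close>, and \<open>z k + r k\<close> is the vector whose image under the transpose of \<open>A\<close> is the
  gradient used in the linearized step.\<close>

abbreviation "z \<equiv> \<lambda>k. - \<rho> *\<^sub>R d k"
abbreviation "r \<equiv> \<lambda>k. \<rho> *\<^sub>R (A *v x k - u k)"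
abbreviation "\<tau> \<equiv> inverse \<rho> * t"

lemma L_pos: "L > 0"
  using L by (smt (verit) zero_le_power2)

lemma u_eq: "u k = A *v x k - (1 / \<rho>) *\<^sub>R r k"
  using \<rho> by simp

lemma d_Suc: "d (Suc k) = d k - A *v x (Suc k) + u (Suc k)"
  using iterates by (simp add: inexact_LALM_def)

lemma r_Suc: "r (Suc k) = z (Suc k) - z k"
  by (simp add: d_Suc algebra_simps)

lemma dual_iterate_subgradient: "subgradient g (u (Suc k)) (z (Suc k))"
proof -
  have "subgradient g (u (Suc k)) (\<rho> *\<^sub>R (A *v x (Suc k) - d k - u (Suc k)))"
    using iterates by (intro subgradient_if_prox g \<rho>) (simp add: inexact_LALM_def algebra_simps)
  also have "\<rho> *\<^sub>R (A *v x (Suc k) - d k - u (Suc k)) = z (Suc k)"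
    by (simp add: d_Suc algebra_simps)
  finally show ?thesis .
qed

lemma phi_eq: "phi A h \<rho> L (x k) (u k) (d k) p
  = h p + ereal (theta A \<rho> (u k) (d k) (x k) + inner (z k + r k) (A *v (p - x k))
      + (1 / \<tau>) / 2 * (norm (p - x k))\<^sup>2)"
proof -
  have "inner (gradient (theta A \<rho> (u k) (d k)) (x k)) (p - x k) = inner (z k + r k) (A *v (p - x k))"
    by (simp add: gradient_theta dot_lmul_matrix algebra_simps)
  moreover have "\<rho> * L / 2 = (1 / \<tau>) / 2" using L_pos \<rho> by (simp add: t field_simps)
  ultimately show ?thesis unfolding phi_def theta_breve_def by (simp only:)
qed

lemma primal_iterate_finite: "h (x (Suc k)) \<noteq> \<infinity>"
  and primal_iterate_approx_min: "h v \<le> ereal b \<Longrightarrow>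
    real_of_ereal (h (x (Suc k))) + inner (transpose A *v (z k + r k)) (x (Suc k))
        + (1 / \<tau>) / 2 * (norm (x (Suc k) - x k))\<^sup>2
      \<le> b + inner (transpose A *v (z k + r k)) v + (1 / \<tau>) / 2 * (norm (v - x k))\<^sup>2 + \<epsilon> k"
proof -
  let ?F = "phi A h \<rho> L (x k) (u k) (d k)"
  have inf: "\<bar>?F (x (Suc k)) - (INF v. ?F v)\<bar> \<le> ereal (\<epsilon> k)"
    using iterates by (simp add: inexact_LALM_def)
  obtain p where "h p \<noteq> \<infinity>" using h by (rule closed_proper_convex_domain)
  then have p: "?F p \<noteq> \<infinity>" by (simp add: phi_def)
  show fin: "h (x (Suc k)) \<noteq> \<infinity>"
    using approximate_infimumD(1)[OF inf p] by (auto simp: phi_def)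
  obtain a where a: "h (x (Suc k)) = ereal a" using closed_proper_convex_finite[OF h fin] by metis
  assume "h v \<le> ereal b"
  then obtain b' where b': "h v = ereal b'" "b' \<le> b"
    using h by (cases "h v") (auto simp: closed_proper_convex_def)
  show "real_of_ereal (h (x (Suc k))) + inner (transpose A *v (z k + r k)) (x (Suc k))
        + (1 / \<tau>) / 2 * (norm (x (Suc k) - x k))\<^sup>2
      \<le> b + inner (transpose A *v (z k + r k)) v + (1 / \<tau>) / 2 * (norm (v - x k))\<^sup>2 + \<epsilon> k"
    using approximate_infimumD(2)[OF inf p, of v] b'
    unfolding phi_eq a b'(1) inner_transpose
    by (simp add: matrix_vector_mult_diff_distrib inner_diff_right)
qed

text \<open>The linearized step is an approximate proximal step of size \<open>\<tau>\<close> for \<open>h\<close>.  The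
  update of \<open>u\<close> followed by that of \<open>d\<close> is, by Moreau's decomposition, an exact proximal
  step of size \<open>\<rho>\<close> for the conjugate of \<open>g\<close>, because \<open>u (Suc k)\<close> is a
  subgradient of the conjugate at \<open>z (Suc k)\<close>.\<close>

sublocale PD: inexact_primal_dual "(*v) A" "\<lambda>p. real_of_ereal (h p)" "{p. h p \<noteq> \<infinity>}"
  "\<lambda>q. real_of_ereal (convex_conjugate g q)" "{q. convex_conjugate g q \<noteq> \<infinity>}"
  "spectral_norm A" \<tau> \<rho> \<epsilon> x z r
proof
  show "norm (A *v v) \<le> spectral_norm A * norm v" for v
    unfolding spectral_norm_def by (rule onorm) simp
  show \<tau>: "\<tau> > 0" using \<rho> L_pos by (simp add: t)
  show "\<tau> * \<rho> * (spectral_norm A)\<^sup>2 < 1"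
    using \<rho> L L_pos by (simp add: t)
  show "x (Suc k) \<in> {p. h p \<noteq> \<infinity>}" for k using primal_iterate_finite by simp
  show "z (Suc k) \<in> {q. convex_conjugate g q \<noteq> \<infinity>}" for k
    using conjugate_at_subgradient[OF dual_iterate_subgradient[of k]] by simp
  fix k
  show "real_of_ereal (h (x (Suc k))) + inner (z k + r k) (A *v (x (Suc k) - p))
      + ((norm (x (Suc k) - x k))\<^sup>2 + (norm (p - x (Suc k)))\<^sup>2 - (norm (p - x k))\<^sup>2) / (2 * \<tau>)
    \<le> real_of_ereal (h p) + \<epsilon> k + sqrt (2 * \<epsilon> k / \<tau>) * norm (p - x (Suc k))"
    if "p \<in> {p. h p \<noteq> \<infinity>}" for p
  proof -
    let ?s = "transpose A *v (z k + r k)"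
    have "real_of_ereal (h (x (Suc k))) + inner ?s (x (Suc k))
        + (1 / \<tau>) / 2 * (norm (x (Suc k) - x k))\<^sup>2 + (1 / \<tau>) / 2 * (norm (p - x (Suc k)))\<^sup>2
      \<le> real_of_ereal (h p) + inner ?s p + (1 / \<tau>) / 2 * (norm (p - x k))\<^sup>2 + \<epsilon> k
        + sqrt (2 * (1 / \<tau>) * \<epsilon> k) * norm (p - x (Suc k))"
    proof (rule approximate_prox_inequality)
      show "convex (epigraph_ereal h)" using h by (simp add: closed_proper_convex_def)
      show "1 / \<tau> > 0" using \<tau> by simp
      show "h (x (Suc k)) = ereal (real_of_ereal (h (x (Suc k))))" "h p = ereal (real_of_ereal (h p))"
        using closed_proper_convex_finite[OF h] primal_iterate_finite that by auto
    qed (rule \<epsilon>_nonneg, rule primal_iterate_approx_min)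
    moreover have "2 * (1 / \<tau>) * \<epsilon> k = 2 * \<epsilon> k / \<tau>" by simp
    moreover have "inner ?s (x (Suc k)) - inner ?s p = inner (z k + r k) (A *v (x (Suc k) - p))"
      unfolding inner_transpose by (simp add: matrix_vector_mult_diff_distrib inner_diff_right)
    moreover have "(b1 + b2 - b3) / (2 * c) = (1 / c) / 2 * b1 + (1 / c) / 2 * b2 - (1 / c) / 2 * b3"
      for b1 b2 b3 c :: real
      by (simp add: add_divide_distrib diff_divide_distrib)
    ultimately show ?thesis by (smt (verit))
  qed
  show "real_of_ereal (convex_conjugate g (z (Suc k)))
      - inner (z (Suc k) - q) (A *v x (Suc k))
      + ((norm (z (Suc k) - z k))\<^sup>2 + (norm (q - z (Suc k)))\<^sup>2 - (norm (q - z k))\<^sup>2) / (2 * \<rho>)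
    \<le> real_of_ereal (convex_conjugate g q)"
    if q: "q \<in> {q. convex_conjugate g q \<noteq> \<infinity>}" for q
  proof -
    note sub = dual_iterate_subgradient[of k]
    obtain b where b: "convex_conjugate g q = ereal b"
      using q conjugate_not_MInf[OF g, of q] by (cases "convex_conjugate g q") auto
    have "inner q (u (Suc k)) - real_of_ereal (g (u (Suc k))) \<le> b"
      using fenchel_young[where f = g, OF subgradientD(1)[OF sub], of q] b by simp
    moreover have "u (Suc k) = A *v x (Suc k) - (1 / \<rho>) *\<^sub>R (z (Suc k) - z k)"
      unfolding r_Suc[symmetric] by (rule u_eq)
    then have "inner (z (Suc k) - q) (u (Suc k)) = inner (z (Suc k) - q) (A *v x (Suc k))
        - inner (z (Suc k) - q) (z (Suc k) - z k) / \<rho>"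
      by (simp only: inner_diff_right inner_scaleR_right) simp
    moreover have "((norm (z' - z0))\<^sup>2 + (norm (q - z'))\<^sup>2 - (norm (q - z0))\<^sup>2) / (2 * \<rho>)
        = inner (z' - q) (z' - z0) / \<rho>" for z' z0
      unfolding power2_norm_eq_inner using \<rho>
      by (simp add: inner_diff_left inner_diff_right inner_commute field_simps)
    ultimately show ?thesis
      unfolding conjugate_at_subgradient[OF sub] b by (simp only: inner_diff_left) simp
  qed
qed (rule matrix_vector_right_distrib matrix_vector_mult_scaleR \<rho> \<epsilon>_nonneg r_Suc)+

lemma saddle_if_saddle_point:
  assumes "saddle_point (Omega A g h) q p"
  shows "PD.saddle q p"
proof -
  have "convex_conjugate g (z (Suc 0)) \<noteq> \<infinity>" using PD.z_in by blast
  from saddle_pointD[OF g h this assms] show ?thesis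
    unfolding PD.saddle_def by blast
qed

section \<open>Convergence and rate\<close>

text \<open>Consecutive iterates merge and \<open>u k - A *v x k\<close> vanishes, so both optimality conditions of
  the updates pass to the limit.  The condition for \<open>g\<close> is the inclusion at \<open>u\<close>, which
  produces a subgradient of \<open>g\<close> itself rather than one of its conjugate.\<close>

lemma limit_point_subgradients:
  assumes saddle: "PD.saddle q p" and summable: "summable (\<lambda>k. sqrt (\<epsilon> k))" and s: "strict_mono s"
    and zs: "(\<lambda>k. z (s k)) \<longlonglongrightarrow> q'" and xs: "(\<lambda>k. x (s k)) \<longlonglongrightarrow> p'"
  shows "subgradient h p' (- (transpose A *v q'))" and "subgradient g (A *v p') q'"
proof -
  note sub = LIMSEQ_subseq_LIMSEQ[OF _ s, unfolded o_def]
  note r_lim = PD.energy_convergent(3)[OF saddle summable]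
  have rs: "(\<lambda>k. r (s k)) \<longlonglongrightarrow> 0" and rs': "(\<lambda>k. r (Suc (s k))) \<longlonglongrightarrow> 0"
    using sub[OF r_lim] sub[OF LIMSEQ_Suc[OF r_lim]] by simp_all
  have xs': "(\<lambda>k. x (Suc (s k))) \<longlonglongrightarrow> p'"
    using tendsto_add[OF sub[OF PD.energy_convergent(2)[OF saddle summable]] xs] by simp
  have zs': "(\<lambda>k. z (Suc (s k))) \<longlonglongrightarrow> q'"
    using tendsto_add[OF rs' zs] unfolding r_Suc by simp
  have A_lim: "(\<lambda>k. A *v v k) \<longlonglongrightarrow> A *v v'" if "v \<longlonglongrightarrow> v'" for v v'
    using that by (rule bounded_linear.tendsto[OF matrix_vector_mul_bounded_linear])
  have us': "(\<lambda>k. u (Suc (s k))) \<longlonglongrightarrow> A *v p'"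
  proof -
    have "(\<lambda>k. A *v x (Suc (s k)) - (1 / \<rho>) *\<^sub>R r (Suc (s k))) \<longlonglongrightarrow> A *v p' - (1 / \<rho>) *\<^sub>R 0"
      by (intro tendsto_intros A_lim xs' rs')
    then show ?thesis unfolding u_eq[symmetric] by simp
  qed
  have \<epsilon>s: "(\<lambda>k. \<epsilon> (s k)) \<longlonglongrightarrow> 0"
    using sub[OF summable_LIMSEQ_zero[OF summable_if_summable_sqrt[OF summable \<epsilon>_nonneg]]] .
  show "subgradient g (A *v p') q'"
  proof (rule subgradient_limit[OF g us'])
    fix v assume v: "g v \<noteq> \<infinity>"
    show "g (u (Suc (s k))) \<le> ereal (real_of_ereal (g v) - inner (z (Suc (s k))) (v - u (Suc (s k))))"
      for k
      using subgradientD(2)[OF dual_iterate_subgradient v, of "s k"]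
        subgradientD(1)[OF dual_iterate_subgradient, of "s k"]
      by (metis ereal_less_eq(3) le_diff_eq)
    show "(\<lambda>k. real_of_ereal (g v) - inner (z (Suc (s k))) (v - u (Suc (s k))))
        \<longlonglongrightarrow> real_of_ereal (g v) - inner q' (v - A *v p')"
      by (intro tendsto_intros zs' us')
  qed
  show "subgradient h p' (- (transpose A *v q'))"
  proof (rule subgradient_limit[OF h xs'])
    fix v assume v: "h v \<noteq> \<infinity>"
    then have dom: "v \<in> {p. h p \<noteq> \<infinity>}" by simp
    define R where "R k = real_of_ereal (h v) + \<epsilon> k + sqrt (2 * \<epsilon> k / \<tau>) * norm (v - x (Suc k))
      - inner (z k + r k) (A *v (x (Suc k) - v))
      - ((norm (x (Suc k) - x k))\<^sup>2 + (norm (v - x (Suc k)))\<^sup>2 - (norm (v - x k))\<^sup>2) / (2 * \<tau>)" for k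
    show "h (x (Suc (s k))) \<le> ereal (R (s k))" for k
    proof -
      have "real_of_ereal (h (x (Suc (s k)))) \<le> R (s k)"
        using PD.x_step[of v "s k", OF dom] by (simp only: R_def le_diff_eq ac_simps)
      then show ?thesis
        using closed_proper_convex_finite[OF h primal_iterate_finite] by (metis ereal_less_eq(3))
    qed
    have "(\<lambda>k. R (s k)) \<longlonglongrightarrow> real_of_ereal (h v) + 0 + sqrt (2 * 0 / \<tau>) * norm (v - p')
      - inner (q' + 0) (A *v (p' - v))
      - ((norm (p' - p'))\<^sup>2 + (norm (v - p'))\<^sup>2 - (norm (v - p'))\<^sup>2) / (2 * \<tau>)"
      unfolding R_def using PD.\<tau>_pos
      by (intro tendsto_intros A_lim zs rs xs xs' \<epsilon>s) auto
    then show "(\<lambda>k. R (s k)) \<longlonglongrightarrow> real_of_ereal (h v) - inner (- (transpose A *v q')) (v - p')"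
      by (simp add: dot_lmul_matrix matrix_vector_mult_diff_distrib inner_diff_right)
  qed
qed

lemma converges:
  assumes saddle: "saddle_point (Omega A g h) q p" and summable: "summable (\<lambda>k. sqrt (\<epsilon> k))"
  shows "\<exists>q' p'. saddle_point_solution A g h q' p' \<and> (\<lambda>k. (z k, x k)) \<longlonglongrightarrow> (q', p')"
proof -
  note saddle' = saddle_if_saddle_point[OF saddle]
  obtain q' p' where lim: "z \<longlonglongrightarrow> q'" "x \<longlonglongrightarrow> p'"
  proof (rule PD.convergence[OF saddle' summable])
    fix s q' p'
    assume "strict_mono s" "(\<lambda>k. z (s k)) \<longlonglongrightarrow> q'" "(\<lambda>k. x (s k)) \<longlonglongrightarrow> p'"
    from limit_point_subgradients[OF saddle' summable this]
    show "PD.saddle q' p'"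
      using saddle_point_solution_if_subgradients[OF g h] saddle_if_saddle_point
      by (simp add: saddle_point_solution_def)
  qed
  have "saddle_point_solution A g h q' p'"
    using limit_point_subgradients[OF saddle' summable strict_mono_id] lim
    by (intro saddle_point_solution_if_subgradients g h) auto
  then show ?thesis using tendsto_Pair[OF lim] by blast
qed

text \<open>By convexity the gap at the averages is at most the average of the gaps.  The assumption on
  \<open>u 0\<close> makes \<open>r 0\<close> vanish, so that the initial energy is a sum of two squares and thus at
  most \<open>C\<^sup>2\<close>.\<close>

lemma averaged_gap_le:
  assumes saddle: "saddle_point (Omega A g h) q p" and u0: "u 0 = A *v x 0" and k: "k \<ge> 1"
  defines "C \<equiv> norm (x 0 - p) / sqrt (2 * inverse \<rho> * t) + norm (z 0 - q) / sqrt (2 * \<rho>)"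
  shows "Omega A g h ((1 / real k) *\<^sub>R (\<Sum>j=1..k. z j)) p - Omega A g h q ((1 / real k) *\<^sub>R (\<Sum>j=1..k. x j))
    \<le> ereal ((C + 2 * (\<Sum>j=1..k. sqrt (\<epsilon> (j - 1) / (1 - t * (spectral_norm A)\<^sup>2)))
        + sqrt (\<Sum>j=1..k. \<epsilon> (j - 1)))\<^sup>2 / real k)"
proof -
  define zb xb where "zb = (1 / real k) *\<^sub>R (\<Sum>j=1..k. z j)"
    and "xb = (1 / real k) *\<^sub>R (\<Sum>j=1..k. x j)"
  define G where "G v = real_of_ereal (convex_conjugate g v)" for v
  define H where "H v = real_of_ereal (h v)" for v
  note saddle' = saddle_if_saddle_point[OF saddle]
  have H: "h v = ereal (H v)" if "h v \<noteq> \<infinity>" for v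
    using closed_proper_convex_finite[OF h that] by (simp add: H_def)
  have G: "convex_conjugate g v = ereal (G v)" if "convex_conjugate g v \<noteq> \<infinity>" for v
    using conjugate_not_MInf[OF g, of v] that by (cases "convex_conjugate g v") (auto simp: G_def)
  have in_dom: "h (x j) = ereal (H (x j))" "convex_conjugate g (z j) = ereal (G (z j))"
    if "j \<in> {1..k}" for j
    using that PD.x_in[of "j - 1"] PD.z_in[of "j - 1"] by (auto intro!: H G)
  have pq: "h p = ereal (H p)" "convex_conjugate g q = ereal (G q)"
    using saddle' by (auto simp: PD.saddle_def intro!: H G)
  have "h xb \<le> ereal ((\<Sum>j=1..k. H (x j)) / real k)"
    unfolding xb_def using h in_dom k
    by (intro epigraph_convex_mean) (auto simp: closed_proper_convex_def)
  moreover have "convex_conjugate g zb \<le> ereal ((\<Sum>j=1..k. G (z j)) / real k)"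
    unfolding zb_def using in_dom k
    by (intro epigraph_convex_mean convex_epigraph_conjugate) auto
  moreover have "h xb = ereal (H xb)" "convex_conjugate g zb = ereal (G zb)"
    using calculation by (auto intro!: H G)
  ultimately have fin: "h xb = ereal (H xb)" "convex_conjugate g zb = ereal (G zb)"
    and mean: "H xb \<le> (\<Sum>j=1..k. H (x j)) / real k" "G zb \<le> (\<Sum>j=1..k. G (z j)) / real k"
    by simp_all
  have "Omega A g h zb p - Omega A g h q xb
      = ereal (G zb - G q - inner zb (A *v p) + H xb - H p + inner q (A *v xb))"
    by (simp add: Omega_def fin pq dot_lmul_matrix)
  also have "G zb - G q - inner zb (A *v p) + H xb - H p + inner q (A *v xb)
      \<le> (\<Sum>j=1..k. PD.gap q p j) / real k"
  proof -
    have "A *v xb = (1 / real k) *\<^sub>R (\<Sum>j=1..k. A *v x j)"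
      by (simp add: xb_def matrix_vector_mult_scaleR vec.linear_sum linear_sum[OF matrix_vector_mul_linear])
    then have "inner q (A *v xb) = (\<Sum>j=1..k. inner q (A *v x j)) / real k"
      by (simp add: inner_sum_right)
    moreover have "inner zb (A *v p) = (\<Sum>j=1..k. inner (z j) (A *v p)) / real k"
      unfolding zb_def inner_scaleR_left inner_sum_left by simp
    moreover have "(\<Sum>j=1..k. PD.gap q p j)
        = (\<Sum>j=1..k. G (z j) - G q - inner (z j) (A *v p) + H (x j) - H p + inner q (A *v x j))"
      by (simp only: PD.gap_def G_def H_def)
    then have "(\<Sum>j=1..k. PD.gap q p j) / real k
      = (\<Sum>j=1..k. G (z j)) / real k - G q - (\<Sum>j=1..k. inner (z j) (A *v p)) / real k
        + (\<Sum>j=1..k. H (x j)) / real k - H p + (\<Sum>j=1..k. inner q (A *v x j)) / real k"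
      using k
      by (simp only:) (simp add: sum.distrib sum_subtractf add_divide_distrib diff_divide_distrib
          del: inner_minus_left inner_scaleR_left)
    ultimately show ?thesis using mean by linarith
  qed
  also have "\<dots> \<le> (C + 2 * (\<Sum>j=1..k. sqrt (\<epsilon> (j - 1) / (1 - t * (spectral_norm A)\<^sup>2)))
        + sqrt (\<Sum>j=1..k. \<epsilon> (j - 1)))\<^sup>2 / real k"
  proof -
    define a b where "a = norm (x 0 - p) / sqrt (2 * inverse \<rho> * t)"
      and "b = norm (z 0 - q) / sqrt (2 * \<rho>)"
    have \<tau>_assoc: "2 * inverse \<rho> * t = 2 * \<tau>" by (rule mult.assoc)
    have ab: "a \<ge> 0" "b \<ge> 0"
      unfolding a_def b_def \<tau>_assoc using PD.\<tau>_pos \<rho> by (intro divide_nonneg_nonneg; simp)+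
    have sq: "a\<^sup>2 = (norm (x 0 - p))\<^sup>2 / (2 * \<tau>)" "b\<^sup>2 = (norm (z 0 - q))\<^sup>2 / (2 * \<rho>)"
      unfolding a_def b_def \<tau>_assoc power_divide using PD.\<tau>_pos \<rho> by simp_all
    have C_eq: "C = a + b" by (simp only: C_def a_def b_def)
    have "PD.energy 1 q p 0 = a\<^sup>2 + b\<^sup>2"
      unfolding PD.energy_def sq u0 by simp
    also have "\<dots> \<le> C\<^sup>2"
      using ab by (simp add: C_eq power2_sum)
    finally have "PD.energy 1 q p 0 \<le> C\<^sup>2" .
    moreover have "C \<ge> 0" using ab by (simp add: C_eq)
    ultimately have "(\<Sum>j<k. PD.gap q p (Suc j)) \<le>
      (C + 2 * (\<Sum>j<k. sqrt (\<epsilon> j / (1 - \<tau> * \<rho> * (spectral_norm A)\<^sup>2))) + sqrt (\<Sum>j<k. \<epsilon> j))\<^sup>2"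
      by (rule PD.gap_sum_le[OF saddle'])
    moreover have "\<tau> * \<rho> = t" using \<rho> by simp
    ultimately show ?thesis
      by (simp add: sum.atLeast1_atMost_eq divide_right_mono del: of_nat_Suc)
  qed
  finally show ?thesis by (simp add: zb_def xb_def)
qed

end

theorem theorem2:
  fixes A :: "real^'n^'m"
    and g :: "real^'m \<Rightarrow> ereal" and h :: "real^'n \<Rightarrow> ereal"
    and zhat :: "real^'m" and xhat :: "real^'n"
    and \<rho> L t C :: real
    and \<epsilon> a a' b :: "nat \<Rightarrow> real"
    and x xbar :: "nat \<Rightarrow> real^'n" and u d zbar :: "nat \<Rightarrow> real^'m"
  assumes g: "closed_proper_convex g"
    and h: "closed_proper_convex h"
    and saddle: "saddle_point_solution A g h zhat xhat"
    and \<rho>: "\<rho> > 0"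
    and L: "L > (spectral_norm A)\<^sup>2"
    and t: "t = 1 / L"
    and \<epsilon>_nonneg: "\<And>k. \<epsilon> k \<ge> 0"
    and \<epsilon>_summable: "summable (\<lambda>k. sqrt (\<epsilon> k))"
    and iterates: "inexact_LALM A g h \<rho> L \<epsilon> x u d"
    and zbar: "\<And>k. zbar k = (1 / real k) *\<^sub>R (\<Sum>j=1..k. - \<rho> *\<^sub>R d j)"
    and xbar: "\<And>k. xbar k = (1 / real k) *\<^sub>R (\<Sum>j=1..k. x j)"
    and C: "C = norm (x 0 - xhat) / sqrt (2 * inverse \<rho> * t)
                + norm (- \<rho> *\<^sub>R d 0 - zhat) / sqrt (2 * \<rho>)"
    and a: "\<And>k. a k = (\<Sum>j=1..k.
              sqrt (\<epsilon> (j - 1) / ((1 - t * (spectral_norm A)\<^sup>2) * inverse \<rho> * t)))"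
    and a': "\<And>k. a' k = (\<Sum>j=1..k. sqrt (\<epsilon> (j - 1) / (1 - t * (spectral_norm A)\<^sup>2)))"
    and b: "\<And>k. b k = (\<Sum>j=1..k. \<epsilon> (j - 1))"
  shows "bounded (range (\<lambda>k. (- \<rho> *\<^sub>R d k, x k))) \<and>
         (\<exists>zstar xstar. saddle_point_solution A g h zstar xstar \<and>
            (\<lambda>k. (- \<rho> *\<^sub>R d k, x k)) \<longlonglongrightarrow> (zstar, xstar)) \<and>
         (u 0 = A *v x 0 \<longrightarrow> (\<forall>k\<ge>1.
            (inverse \<rho> * t \<le> 1 \<longrightarrow>
               Omega A g h (zbar k) xhat - Omega A g h zhat (xbar k)
                 \<le> ereal ((C + 2 * a k + sqrt (b k))\<^sup>2 / real k)) \<and>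
            Omega A g h (zbar k) xhat - Omega A g h zhat (xbar k)
              \<le> ereal ((C + 2 * a' k + sqrt (b k))\<^sup>2 / real k)))"
proof -
  interpret inexact_linearized_ALM A g h \<rho> L t \<epsilon> x u d
    using g h \<rho> L t \<epsilon>_nonneg iterates by unfold_locales
  have saddle': "saddle_point (Omega A g h) zhat xhat"
    using saddle by (simp add: saddle_point_solution_def)
  have conv: "\<exists>zstar xstar. saddle_point_solution A g h zstar xstar \<and>
      (\<lambda>k. (- \<rho> *\<^sub>R d k, x k)) \<longlonglongrightarrow> (zstar, xstar)"
    by (rule converges[OF saddle' \<epsilon>_summable])
  then have bounded: "bounded (range (\<lambda>k. (- \<rho> *\<^sub>R d k, x k)))"
    by (blast intro: convergent_imp_bounded)
  have rate: "Omega A g h (zbar k) xhat - Omega A g h zhat (xbar k)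
      \<le> ereal ((C + 2 * a' k + sqrt (b k))\<^sup>2 / real k)" if "u 0 = A *v x 0" "k \<ge> 1" for k
    using averaged_gap_le[OF saddle' that] by (simp only: zbar xbar C a' b)
  \<comment> \<open>When \<open>inverse \<rho> * t \<le> 1\<close>, dividing by it as well can only enlarge the error sum.\<close>
  have weaker: "ereal ((C + 2 * a' k + sqrt (b k))\<^sup>2 / real k)
      \<le> ereal ((C + 2 * a k + sqrt (b k))\<^sup>2 / real k)" if \<tau>_le: "inverse \<rho> * t \<le> 1" for k
  proof -
    define \<kappa> where "\<kappa> = 1 - t * (spectral_norm A)\<^sup>2"
    have t0: "t > 0" using L_pos by (simp add: t)
    have \<kappa>: "\<kappa> > 0" using L L_pos by (simp add: \<kappa>_def t)
    have \<tau>0: "inverse \<rho> * t > 0" using \<rho> t0 by simp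
    have "0 \<le> a' k" unfolding a' using \<kappa> \<epsilon>_nonneg by (auto simp: \<kappa>_def intro!: sum_nonneg)
    moreover have "0 \<le> b k" unfolding b using \<epsilon>_nonneg by (auto intro!: sum_nonneg)
    moreover have "0 \<le> C"
      unfolding C using \<rho> t0 by (intro add_nonneg_nonneg divide_nonneg_nonneg) auto
    moreover have "a' k \<le> a k"
      unfolding a a' \<kappa>_def[symmetric]
    proof (intro sum_mono real_sqrt_le_mono divide_left_mono)
      show "\<kappa> * inverse \<rho> * t \<le> \<kappa>"
        using mult_left_mono[OF \<tau>_le, of \<kappa>] \<kappa> by (simp add: mult.assoc)
      show "0 < \<kappa> * (\<kappa> * inverse \<rho> * t)"
        using \<kappa> \<rho> t0 by simp
    qed (rule \<epsilon>_nonneg)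
    ultimately show ?thesis
      unfolding ereal_less_eq by (intro divide_right_mono power_mono) auto
  qed
  show ?thesis
    by (intro conjI impI allI bounded conv rate order_trans[OF rate weaker])
qed

end
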